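(* Let $\sigma>0$, $x>0$ and $-x<\mu<0$, and let $\{W_n,n\ge0\}$ be the Lindley process started at $W_0=x$ with Laplace increments with location $\mu$ and scale $\sigma$. Put $$I_n^0=\{0\},\quad I_n^1=(0,\max(0,n\mu+x)),\quad I_n^2=(\max(0,n\mu+x),+\infty).$$ Then $f_0(u)=\delta(u-x)$ and for $n\ge1$, $u\ge0$ the probability density function of $W_n$ is $f_n(u)=\sum_{i=0}^2f_n^i(u)$, where $f_n^0(u)=c_n\delta(u)$ and $$f_n^i(u)=\Big\{\sum_{j=0}^{n-1}\frac1{(2\sigma)^n}\big[a_n^{(i,j)}(u-n\mu)^je^{u/\sigma}+b_n^{(i,j)}(u-n\mu)^je^{-u/\sigma}\big]\Big\}\mathbf 1_{I_n^i}(u),\qquad i=1,2,$$ with coefficients given by the initial values $$a_1^{(1,0)}=e^{-(\mu+x)/\sigma},\quad b_1^{(1,0)}=0,\quad a_1^{(2,0)}=0,\quad b_1^{(2,0)}=e^{(\mu+x)/\sigma},\quad c_1=\tfrac12e^{-(\mu+x)/\sigma}$$ and the recursion below for $n\ge1$. For fixed $n$ write $$G_k(p,q)=e^{2n\mu/\sigma}\sigma^{k+1}(-1)^k\,\Gamma\Big(1+k,\frac{-(y-n\mu)}\sigma\Big)\Big|_{p}^{q},\qquad H_k(p,q)=e^{-2n\mu/\sigma}\sigma^{k+1}\,\Gamma\Big(1+k,\frac{y-n\mu}\sigma\Big)\Big|_{p}^{q},$$ $$R_k(p,q)=\frac{e^{2n\mu/\sigma}\sigma^{k+1}(-1)^k}{2^{k+1}}\Gamma\Big(1+k,\frac{-2(y-n\mu)}\sigma\Big)\Big|_{p}^{q},\qquad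 S_k(p,q)=\frac{e^{-2n\mu/\sigma}\sigma^{k+1}}{2^{k+1}}\Gamma\Big(1+k,\frac{2(y-n\mu)}\sigma\Big)\Big|_{p}^{q},$$ $$Q_k(p,q)=\frac{(y-n\mu)^{k+1}}{k+1}\Big|_p^q .$$ (A) If $x+n\mu>0$: for $i=1,2$ and $1\le j\le n$, $$a_{n+1}^{(i,j)}=e^{-\mu/\sigma}\sum_{k=j-1}^{n-1}(-1)^{k+j}a_n^{(i,k)}\frac{k!}{j!}\Big(\frac\sigma2\Big)^{k-j+1},\qquad b_{n+1}^{(i,j)}=e^{\mu/\sigma}\sum_{k=j-1}^{n-1}b_n^{(i,k)}\frac{k!}{j!}\Big(\frac\sigma2\Big)^{k-j+1},$$ $$a_{n+1}^{(1,0)}=e^{-\mu/\sigma}\Big[B_2+\sum_{k=0}^{n-1}\Big\{a_n^{(1,k)}\Big(\frac{x^{k+1}}{k+1}+(-1)^kk!\Big(\frac\sigma2\Big)^{k+1}\Big)-b_n^{(1,k)}\frac{e^{-2n\mu/\sigma}\sigma^{k+1}}{2^{k+1}}\Gamma\Big(1+k,\frac{2x}\sigma\Big)\Big\}\Big],$$ $$b_{n+1}^{(1,0)}=e^{\mu/\sigma}\Big[\sum_{k=0}^{n-1}\Big\{b_n^{(1,k)}\Big(-\frac{(-n\mu)^{k+1}}{k+1}+k!\Big(\frac\sigma2\Big)^{k+1}\Big)-a_n^{(1,k)}\frac{e^{2n\mu/\sigma}\sigma^{k+1}(-1)^k}{2^{k+1}}\Gamma\Big(1+k,\frac{2n\mu}\sigma\Big)\Big\}+(2\sigma)^nc_n\Big],$$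 $$a_{n+1}^{(2,0)}=0,$$ $$b_{n+1}^{(2,0)}=e^{\mu/\sigma}\Big[B_1+\sum_{k=0}^{n-1}\Big\{b_n^{(2,k)}\Big(-\frac{x^{k+1}}{k+1}+k!\Big(\frac\sigma2\Big)^{k+1}\Big)-a_n^{(2,k)}\frac{e^{2n\mu/\sigma}\sigma^{k+1}(-1)^k}{2^{k+1}}\Gamma\Big(1+k,-\frac{2x}\sigma\Big)\Big\}+(2\sigma)^nc_n\Big],$$ where $$B_1=\sum_{k=0}^{n-1}\big\{a_n^{(1,k)}R_k(0,x+n\mu)+b_n^{(1,k)}Q_k(0,x+n\mu)\big\},\qquad B_2=\sum_{k=0}^{n-1}b_n^{(2,k)}\frac{e^{-2n\mu/\sigma}\sigma^{k+1}}{2^{k+1}}\Gamma\Big(1+k,\frac{2x}\sigma\Big).$$ Moreover $c_{n+1}=\tilde f_{n+1}(0)+\tilde{\tilde f}_{n+1}(0)$ for $n\ge1$, where $$\tilde f_{n+1}(0)=\Big\{\frac1{(2\sigma)^n}\sum_{k=0}^{n-1}\big[a_n^{(1,k)}G_k(0,x+n\mu)+b_n^{(1,k)}H_k(0,x+n\mu)\big]-\frac{e^{\mu/\sigma}}{2^{n+1}\sigma^n}\sum_{k=0}^{n-1}\big[a_n^{(1,k)}R_k(0,x+n\mu)+b_n^{(1,k)}Q_k(0,x+n\mu)\big]$$ $$+\frac1{(2\sigma)^n}\sum_{k=0}^{n-1}\big[a_n^{(2,k)}G_k(x+n\mu,-\mu)+b_n^{(2,k)}H_k(x+n\mu,-\mu)\big]-\frac{e^{\mu/\sigma}}{2^{n+1}\sigma^n}\sum_{k=0}^{n-1}\big[a_n^{(2,k)}R_k(x+n\mu,-\mu)+b_n^{(2,k)}Q_k(x+n\mu,-\mu)\big]$$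 $$+\frac{e^{-\mu/\sigma}}{2^{n+1}\sigma^n}\sum_{k=0}^{n-1}b_n^{(2,k)}\frac{e^{-2n\mu/\sigma}\sigma^{k+1}}{2^{k+1}}\Gamma\Big(1+k,-\frac{2(n+1)\mu}\sigma\Big)+\Big(1-\frac{e^{\mu/\sigma}}2\Big)c_n\Big\}\mathbf 1_{[0,-(n+1)\mu)}(x)$$ and $$\tilde{\tilde f}_{n+1}(0)=\Big\{\frac1{(2\sigma)^n}\sum_{k=0}^{n-1}\big[a_n^{(1,k)}G_k(0,-\mu)+b_n^{(1,k)}H_k(0,-\mu)\big]-\frac{e^{\mu/\sigma}}{2^{n+1}\sigma^n}\sum_{k=0}^{n-1}\big[a_n^{(1,k)}R_k(0,-\mu)+b_n^{(1,k)}Q_k(0,-\mu)\big]$$ $$+\frac{e^{-\mu/\sigma}}{2^{n+1}\sigma^n}\sum_{k=0}^{n-1}\big[a_n^{(1,k)}Q_k(-\mu,x+n\mu)+b_n^{(1,k)}S_k(-\mu,x+n\mu)\big]+\frac{e^{-\mu/\sigma}}{2^{n+1}\sigma^n}\sum_{k=0}^{n-1}b_n^{(2,k)}\frac{e^{-2n\mu/\sigma}\sigma^{k+1}}{2^{k+1}}\Gamma\Big(1+k,\frac{2x}\sigma\Big)+\Big(1-\frac{e^{\mu/\sigma}}2\Big)c_n\Big\}\mathbf 1_{[-(n+1)\mu,\infty)}(x).$$ (B) If $x+n\mu<0$: $f_n^1\equiv0$, and for $1\le j\le n$, $$a_{n+1}^{(2,j)}=0,\qquad a_{n+1}^{(2,0)}=0,\qquad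 b_{n+1}^{(2,j)}=e^{\mu/\sigma}\sum_{k=j-1}^{n-1}b_n^{(2,k)}\frac{k!}{j!}\Big(\frac\sigma2\Big)^{k-j+1},$$ $$b_{n+1}^{(2,0)}=e^{\mu/\sigma}\Big[\sum_{k=0}^{n-1}\Big\{b_n^{(2,k)}\Big(-\frac{(-n\mu)^{k+1}}{k+1}+k!\Big(\frac\sigma2\Big)^{k+1}\Big)-a_n^{(2,k)}\frac{e^{2n\mu/\sigma}\sigma^{k+1}(-1)^k}{2^{k+1}}\Gamma\Big(1+k,\frac{2n\mu}\sigma\Big)\Big\}+(2\sigma)^nc_n\Big],$$ $$c_{n+1}=\frac1{(2\sigma)^n}\sum_{k=0}^{n-1}b_n^{(2,k)}H_k(0,-\mu)-\frac{e^{\mu/\sigma}}{2^{n+1}\sigma^n}\sum_{k=0}^{n-1}b_n^{(2,k)}Q_k(0,-\mu)+\frac{e^{-\mu/\sigma}}{2^{n+1}\sigma^n}\sum_{k=0}^{n-1}b_n^{(2,k)}\frac{e^{-2n\mu/\sigma}\sigma^{k+1}}{2^{k+1}}\Gamma\Big(1+k,\frac{-2(n+1)\mu}\sigma\Big)+\Big(1-\frac{e^{\mu/\sigma}}2\Big)c_n,$$ with the initial values of $a_1^{(2,0)}$, $b_1^{(2,0)}$ and $c_1$ given above.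
   Context: Lindley process with Laplace increments: $Z_1,Z_2,\dots$ are i.i.d. real random variables with density $f_Z(z)=\frac{1}{2\sigma}e^{-|z-\mu|/\sigma}$, and $W_0=x$, $W_n=\max(0,W_{n-1}+Z_n)$ for $n\ge1$. $f_n(u)=f_n(u|x)$ denotes the probability density of $W_n$ given $W_0=x$, i.e. the distributional derivative in $u$ of $\mathbb P(W_n\le u\mid W_0=x)$; $W_n$ is a mixed random variable, with an atom $c_n\delta(u)$ at $0$ plus an ordinary density on $(0,\infty)$. $\delta$ is the Dirac delta at $0$, with the convention that its full mass is counted on $[0,\infty)$. $\Gamma(m,y)=\int_y^\infty t^{m-1}e^{-t}\,dt$ is the incomplete Gamma function ($m\ge1$ integer, $y$ real). $\phi(y)|_p^q=\phi(q)-\phi(p)$. Empty sums are $0$.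
   Formalization: The prefactors of G_k, H_k, S_k are corrected: e^{nμ/σ} in G_k, −e^{−nμ/σ} in H_k, and a minus sign in S_k (as printed, c_2 is wrong, e.g. for μ=−1, σ=1, x=2); at x+nμ=0, where no recursion is given, recursion (B) is used. *)

theory Defs
  imports "HOL-Probability.Probability"
begin

definition laplace_density :: "real \<Rightarrow> real \<Rightarrow> real \<Rightarrow> real" where
  "laplace_density \<mu> \<sigma> z = 1 / (2 * \<sigma>) * exp (- \<bar>z - \<mu>\<bar> / \<sigma>)"

fun lindley :: "real \<Rightarrow> (nat \<Rightarrow> 'a \<Rightarrow> real) \<Rightarrow> nat \<Rightarrow> 'a \<Rightarrow> real" where
  "lindley x Z 0 \<omega> = x"
| "lindley x Z (Suc n) \<omega> = max 0 (lindley x Z n \<omega> + Z (Suc n) \<omega>)"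

text \<open>
  Distributions on the real line are represented by their values on smooth, compactly supported
  test functions. Test functions are defined on the whole line, so the Dirac delta at 0 has its
  full mass on the closed half-line.
\<close>

definition test_function :: "(real \<Rightarrow> real) \<Rightarrow> bool" where
  "test_function \<phi> \<longleftrightarrow>
     (\<forall>k u. ((deriv ^^ k) \<phi>) field_differentiable (at u)) \<and>
     (\<exists>K. compact K \<and> (\<forall>u. u \<notin> K \<longrightarrow> \<phi> u = 0))"

definition dirac :: "real \<Rightarrow> (real \<Rightarrow> real) \<Rightarrow> real" where
  "dirac p \<phi> = \<phi> p"

definition regular_distribution :: "(real \<Rightarrow> real) \<Rightarrow> (real \<Rightarrow> real) \<Rightarrow> real" where
  "regular_distribution g \<phi> = (\<integral>u. g u * \<phi> u \<partial>lborel)"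

definition has_distributional_derivative ::
    "(real \<Rightarrow> real) \<Rightarrow> ((real \<Rightarrow> real) \<Rightarrow> real) \<Rightarrow> bool" where
  "has_distributional_derivative F T \<longleftrightarrow>
     (\<forall>\<phi>. test_function \<phi> \<longrightarrow> T \<phi> = - (\<integral>u. F u * deriv \<phi> u \<partial>lborel))"

definition inc_Gamma :: "nat \<Rightarrow> real \<Rightarrow> real" where
  "inc_Gamma m y = (LBINT t:{y..}. t ^ (m - 1) * exp (- t))"

definition eval_between :: "(real \<Rightarrow> real) \<Rightarrow> real \<Rightarrow> real \<Rightarrow> real" where
  "eval_between \<phi> p q = \<phi> q - \<phi> p"

context
  fixes \<mu> \<sigma> x :: real
begin

definition I1 :: "nat \<Rightarrow> real set" where
  "I1 n = {0 <..< max 0 (real n * \<mu> + x)}"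

definition I2 :: "nat \<Rightarrow> real set" where
  "I2 n = {max 0 (real n * \<mu> + x) <..}"

text \<open>
  The increments \<open>G\<close>, \<open>H\<close>, \<open>R\<close>, \<open>S\<close>, \<open>Q\<close> are the integrals over \<open>p \<le> y \<le> q\<close> of
  \<open>(y - n \<mu>) ^ k\<close> times, respectively, \<open>exp (y / \<sigma>)\<close>, \<open>exp (- y / \<sigma>)\<close>, \<open>exp (2 y / \<sigma>)\<close>,
  \<open>exp (- 2 y / \<sigma>)\<close> and \<open>1\<close>.

  Pitfall: three prefactors differ from the printed source, which has \<open>exp (2 n \<mu> / \<sigma>)\<close> in \<open>G\<close>,
  \<open>+ exp (- 2 n \<mu> / \<sigma>)\<close> in \<open>H\<close> and \<open>+ exp (- 2 n \<mu> / \<sigma>)\<close> in \<open>S\<close>. With those the terms are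
  not the above integrals and the atom of \<open>W\<^sub>2\<close> already comes out wrong: for \<open>\<mu> = -1\<close>,
  \<open>\<sigma> = 1\<close>, \<open>x = 2\<close> it would be 0.283... instead of the true 0.483...
\<close>

definition G :: "nat \<Rightarrow> nat \<Rightarrow> real \<Rightarrow> real \<Rightarrow> real" where
  "G n k p q = exp (real n * \<mu> / \<sigma>) * \<sigma> ^ (k + 1) * (- 1) ^ k *
     eval_between (\<lambda>y. inc_Gamma (1 + k) (- (y - real n * \<mu>) / \<sigma>)) p q"

definition H :: "nat \<Rightarrow> nat \<Rightarrow> real \<Rightarrow> real \<Rightarrow> real" where
  "H n k p q = - exp (- real n * \<mu> / \<sigma>) * \<sigma> ^ (k + 1) *
     eval_between (\<lambda>y. inc_Gamma (1 + k) ((y - real n * \<mu>) / \<sigma>)) p q"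

definition R :: "nat \<Rightarrow> nat \<Rightarrow> real \<Rightarrow> real \<Rightarrow> real" where
  "R n k p q = exp (2 * real n * \<mu> / \<sigma>) * \<sigma> ^ (k + 1) * (- 1) ^ k / 2 ^ (k + 1) *
     eval_between (\<lambda>y. inc_Gamma (1 + k) (- 2 * (y - real n * \<mu>) / \<sigma>)) p q"

definition S :: "nat \<Rightarrow> nat \<Rightarrow> real \<Rightarrow> real \<Rightarrow> real" where
  "S n k p q = - exp (- 2 * real n * \<mu> / \<sigma>) * \<sigma> ^ (k + 1) / 2 ^ (k + 1) *
     eval_between (\<lambda>y. inc_Gamma (1 + k) (2 * (y - real n * \<mu>) / \<sigma>)) p q"

definition Q :: "nat \<Rightarrow> nat \<Rightarrow> real \<Rightarrow> real \<Rightarrow> real" where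
  "Q n k p q = eval_between (\<lambda>y. (y - real n * \<mu>) ^ (k + 1) / real (k + 1)) p q"

context
  fixes a b :: "nat \<Rightarrow> nat \<Rightarrow> nat \<Rightarrow> real" and c :: "nat \<Rightarrow> real"
begin

text \<open>
  \<open>a n i j\<close> and \<open>b n i j\<close> are the coefficients with subscript \<open>n\<close> and superscript \<open>(i, j)\<close>.
\<close>

definition density_piece :: "nat \<Rightarrow> nat \<Rightarrow> real set \<Rightarrow> real \<Rightarrow> real" where
  "density_piece n i I u =
     (\<Sum>j = 0..<n. 1 / (2 * \<sigma>) ^ n *
        (a n i j * (u - real n * \<mu>) ^ j * exp (u / \<sigma>) +
         b n i j * (u - real n * \<mu>) ^ j * exp (- u / \<sigma>))) * indicator I u"

definition initial_values :: bool where
  "initial_values \<longleftrightarrow>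
     a 1 1 0 = exp (- (\<mu> + x) / \<sigma>) \<and> b 1 1 0 = 0 \<and>
     a 1 2 0 = 0 \<and> b 1 2 0 = exp ((\<mu> + x) / \<sigma>) \<and>
     c 1 = 1 / 2 * exp (- (\<mu> + x) / \<sigma>)"

definition B1 :: "nat \<Rightarrow> real" where
  "B1 n = (\<Sum>k = 0..<n. a n 1 k * R n k 0 (x + real n * \<mu>) + b n 1 k * Q n k 0 (x + real n * \<mu>))"

definition B2 :: "nat \<Rightarrow> real" where
  "B2 n = (\<Sum>k = 0..<n. b n 2 k * (exp (- 2 * real n * \<mu> / \<sigma>) * \<sigma> ^ (k + 1) / 2 ^ (k + 1)) *
             inc_Gamma (1 + k) (2 * x / \<sigma>))"

definition f_tilde :: "nat \<Rightarrow> real" where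
  "f_tilde n =
     (1 / (2 * \<sigma>) ^ n *
        (\<Sum>k = 0..<n. a n 1 k * G n k 0 (x + real n * \<mu>) + b n 1 k * H n k 0 (x + real n * \<mu>))
      - exp (\<mu> / \<sigma>) / (2 ^ (n + 1) * \<sigma> ^ n) *
        (\<Sum>k = 0..<n. a n 1 k * R n k 0 (x + real n * \<mu>) + b n 1 k * Q n k 0 (x + real n * \<mu>))
      + 1 / (2 * \<sigma>) ^ n *
        (\<Sum>k = 0..<n. a n 2 k * G n k (x + real n * \<mu>) (- \<mu>) + b n 2 k * H n k (x + real n * \<mu>) (- \<mu>))
      - exp (\<mu> / \<sigma>) / (2 ^ (n + 1) * \<sigma> ^ n) *
        (\<Sum>k = 0..<n. a n 2 k * R n k (x + real n * \<mu>) (- \<mu>) + b n 2 k * Q n k (x + real n * \<mu>) (- \<mu>))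
      + exp (- \<mu> / \<sigma>) / (2 ^ (n + 1) * \<sigma> ^ n) *
        (\<Sum>k = 0..<n. b n 2 k * (exp (- 2 * real n * \<mu> / \<sigma>) * \<sigma> ^ (k + 1) / 2 ^ (k + 1)) *
           inc_Gamma (1 + k) (- 2 * real (n + 1) * \<mu> / \<sigma>))
      + (1 - exp (\<mu> / \<sigma>) / 2) * c n)
     * indicator {0 ..< - real (n + 1) * \<mu>} x"

definition f_tilde_tilde :: "nat \<Rightarrow> real" where
  "f_tilde_tilde n =
     (1 / (2 * \<sigma>) ^ n *
        (\<Sum>k = 0..<n. a n 1 k * G n k 0 (- \<mu>) + b n 1 k * H n k 0 (- \<mu>))
      - exp (\<mu> / \<sigma>) / (2 ^ (n + 1) * \<sigma> ^ n) *
        (\<Sum>k = 0..<n. a n 1 k * R n k 0 (- \<mu>) + b n 1 k * Q n k 0 (- \<mu>))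
      + exp (- \<mu> / \<sigma>) / (2 ^ (n + 1) * \<sigma> ^ n) *
        (\<Sum>k = 0..<n. a n 1 k * Q n k (- \<mu>) (x + real n * \<mu>) + b n 1 k * S n k (- \<mu>) (x + real n * \<mu>))
      + exp (- \<mu> / \<sigma>) / (2 ^ (n + 1) * \<sigma> ^ n) *
        (\<Sum>k = 0..<n. b n 2 k * (exp (- 2 * real n * \<mu> / \<sigma>) * \<sigma> ^ (k + 1) / 2 ^ (k + 1)) *
           inc_Gamma (1 + k) (2 * x / \<sigma>))
      + (1 - exp (\<mu> / \<sigma>) / 2) * c n)
     * indicator {- real (n + 1) * \<mu> ..} x"

definition recursion_A :: "nat \<Rightarrow> bool" where
  "recursion_A n \<longleftrightarrow>
     (\<forall>i \<in> {1, 2}. \<forall>j \<in> {1..n}.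
        a (n + 1) i j = exp (- \<mu> / \<sigma>) *
          (\<Sum>k = j - 1..<n. (- 1) ^ (k + j) * a n i k * (fact k / fact j) * (\<sigma> / 2) ^ (k + 1 - j)) \<and>
        b (n + 1) i j = exp (\<mu> / \<sigma>) *
          (\<Sum>k = j - 1..<n. b n i k * (fact k / fact j) * (\<sigma> / 2) ^ (k + 1 - j))) \<and>
     a (n + 1) 1 0 = exp (- \<mu> / \<sigma>) * (B2 n +
       (\<Sum>k = 0..<n.
          a n 1 k * (x ^ (k + 1) / real (k + 1) + (- 1) ^ k * fact k * (\<sigma> / 2) ^ (k + 1))
        - b n 1 k * (exp (- 2 * real n * \<mu> / \<sigma>) * \<sigma> ^ (k + 1) / 2 ^ (k + 1)) *
            inc_Gamma (1 + k) (2 * x / \<sigma>))) \<and>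
     b (n + 1) 1 0 = exp (\<mu> / \<sigma>) *
       ((\<Sum>k = 0..<n.
          b n 1 k * (- ((- real n * \<mu>) ^ (k + 1) / real (k + 1)) + fact k * (\<sigma> / 2) ^ (k + 1))
        - a n 1 k * (exp (2 * real n * \<mu> / \<sigma>) * \<sigma> ^ (k + 1) * (- 1) ^ k / 2 ^ (k + 1)) *
            inc_Gamma (1 + k) (2 * real n * \<mu> / \<sigma>))
        + (2 * \<sigma>) ^ n * c n) \<and>
     a (n + 1) 2 0 = 0 \<and>
     b (n + 1) 2 0 = exp (\<mu> / \<sigma>) * (B1 n +
       (\<Sum>k = 0..<n.
          b n 2 k * (- (x ^ (k + 1) / real (k + 1)) + fact k * (\<sigma> / 2) ^ (k + 1))
        - a n 2 k * (exp (2 * real n * \<mu> / \<sigma>) * \<sigma> ^ (k + 1) * (- 1) ^ k / 2 ^ (k + 1)) *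
            inc_Gamma (1 + k) (- (2 * x / \<sigma>)))
        + (2 * \<sigma>) ^ n * c n) \<and>
     c (n + 1) = f_tilde n + f_tilde_tilde n"

text \<open>
  This case leaves the coefficients with first superscript 1 unspecified: from here on the
  interval \<open>I1\<close> is empty.
\<close>

definition recursion_B :: "nat \<Rightarrow> bool" where
  "recursion_B n \<longleftrightarrow>
     (\<forall>j \<in> {1..n}.
        a (n + 1) 2 j = 0 \<and>
        b (n + 1) 2 j = exp (\<mu> / \<sigma>) *
          (\<Sum>k = j - 1..<n. b n 2 k * (fact k / fact j) * (\<sigma> / 2) ^ (k + 1 - j))) \<and>
     a (n + 1) 2 0 = 0 \<and>
     b (n + 1) 2 0 = exp (\<mu> / \<sigma>) *
       ((\<Sum>k = 0..<n.
          b n 2 k * (- ((- real n * \<mu>) ^ (k + 1) / real (k + 1)) + fact k * (\<sigma> / 2) ^ (k + 1))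
        - a n 2 k * (exp (2 * real n * \<mu> / \<sigma>) * \<sigma> ^ (k + 1) * (- 1) ^ k / 2 ^ (k + 1)) *
            inc_Gamma (1 + k) (2 * real n * \<mu> / \<sigma>))
        + (2 * \<sigma>) ^ n * c n) \<and>
     c (n + 1) =
       1 / (2 * \<sigma>) ^ n * (\<Sum>k = 0..<n. b n 2 k * H n k 0 (- \<mu>))
       - exp (\<mu> / \<sigma>) / (2 ^ (n + 1) * \<sigma> ^ n) * (\<Sum>k = 0..<n. b n 2 k * Q n k 0 (- \<mu>))
       + exp (- \<mu> / \<sigma>) / (2 ^ (n + 1) * \<sigma> ^ n) *
         (\<Sum>k = 0..<n. b n 2 k * (exp (- 2 * real n * \<mu> / \<sigma>) * \<sigma> ^ (k + 1) / 2 ^ (k + 1)) *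
            inc_Gamma (1 + k) (- 2 * real (n + 1) * \<mu> / \<sigma>))
       + (1 - exp (\<mu> / \<sigma>) / 2) * c n"

text \<open>
  At \<open>x + n \<mu> = 0\<close>, where the source gives no recursion, we use the second case; there the two
  cases agree on \<open>c\<close> and on all coefficients with first superscript 2.
\<close>

definition lindley_coefficients :: bool where
  "lindley_coefficients \<longleftrightarrow>
     initial_values \<and>
     (\<forall>n \<ge> 1. (x + real n * \<mu> > 0 \<longrightarrow> recursion_A n) \<and>
              (x + real n * \<mu> \<le> 0 \<longrightarrow> recursion_B n))"

end

end

end

theory Submission
  imports Defs
begin

text \<open>
  The theorem holds because the coefficient recursion is the Chapman-Kolmogorov step of the Lindley
  chain, carried out explicitly on densities that are polynomials times exponentials.

  By Fubini, the distributional derivative of a distribution function is integration against the law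
  (\<open>cdf_has_distributional_derivative\<close>). It therefore suffices to show, by induction on \<open>n\<close>, that the
  law of \<open>W\<^sub>n\<close> is an atom of mass \<open>c n\<close> at \<open>0\<close> plus the density built from \<open>a\<close> and \<open>b\<close>; see
  \<open>mixed_law\<close> and \<open>mixed_law_lindley\<close>. Since \<open>W\<^sub>n\<close> is a function of the first \<open>n\<close> increments, it is
  independent of the next one, and a reflected step with increment density \<open>f\<close> and distribution
  function \<open>F\<close> turns an atom \<open>c\<close> and a density \<open>p\<close> into the atom \<open>c F(0) + \<integral> p(w) F(-w) dw\<close> and the
  density \<open>c f(u) + \<integral> p(w) f(u - w) dw\<close> on \<open>u > 0\<close> (\<open>mixed_law_step\<close>).

  For Laplace increments both \<open>w \<mapsto> f(u - w)\<close> and \<open>w \<mapsto> F(-w)\<close> have one shape: below a threshold \<open>v\<close>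
  a constant plus a multiple of \<open>exp (w / \<sigma>)\<close>, above it a multiple of \<open>exp (- w / \<sigma>)\<close>, where
  \<open>v = u - \<mu>\<close> in the first case and \<open>v = - \<mu>\<close> in the second. So a single pair of integrals is needed,
  according to whether \<open>v\<close> lies below or above the point \<open>m = max 0 (x + n \<mu>)\<close> at which the density
  changes its formula (\<open>integral_exp_kernel_below\<close>, \<open>integral_exp_kernel_above\<close>); they are
  sums of the increments \<open>G\<close>, \<open>H\<close>, \<open>R\<close>, \<open>S\<close>, \<open>Q\<close> and of one improper integral. With \<open>v = - \<mu>\<close> they are
  the formulas for the next atom. With \<open>v = u - \<mu>\<close> one has \<open>v - n \<mu> = u - (n + 1) \<mu>\<close>, so the closed form
  of the incomplete Gamma function gives polynomials in the variable of the next density, and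
  interchanging two finite sums (\<open>polynomial_of_recursion\<close>) yields the recursion for \<open>a\<close> and \<open>b\<close>.
  The coefficients \<open>a n 2 k\<close>, \<open>k < n\<close>, vanish throughout, which is what makes the unbounded piece
  integrable.
\<close>

section \<open>The distributional derivative of a distribution function\<close>


lemma test_function_derivative:
  assumes "test_function \<phi>"
  shows "\<And>u. (\<phi> has_real_derivative deriv \<phi> u) (at u)"
    and "continuous_on UNIV (deriv \<phi>)"
proof -
  have d: "((deriv ^^ k) \<phi>) field_differentiable (at u)" for k u
    using assms unfolding test_function_def by blast
  show "(\<phi> has_real_derivative deriv \<phi> u) (at u)" for u
    using d[of 0 u] by (simp add: field_differentiable_derivI)
  have "isCont (deriv \<phi>) u" for u
    using field_differentiable_imp_continuous_at[OF d[of 1 u]] by simp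
  then show "continuous_on UNIV (deriv \<phi>)"
    by (simp add: continuous_at_imp_continuous_on)
qed

lemma test_function_support:
  assumes "test_function \<phi>"
  obtains r where "\<And>u. r < \<bar>u\<bar> \<Longrightarrow> \<phi> u = 0" "\<And>u. r < \<bar>u\<bar> \<Longrightarrow> deriv \<phi> u = 0"
proof -
  obtain K where K: "compact K" "\<And>u. u \<notin> K \<Longrightarrow> \<phi> u = 0"
    using assms unfolding test_function_def by blast
  obtain r where r: "\<And>u. u \<in> K \<Longrightarrow> \<bar>u\<bar> \<le> r"
    using compact_imp_bounded[OF K(1)] unfolding bounded_iff by auto
  have z: "\<phi> u = 0" if "r < \<bar>u\<bar>" for u
    using r[of u] K(2)[of u] that by fastforce
  have "deriv \<phi> u = 0" if u: "r < \<bar>u\<bar>" for u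
  proof -
    have "open {v::real. r < \<bar>v\<bar>}" by (intro open_Collect_less continuous_intros)
    then have "\<forall>\<^sub>F v in nhds u. v \<in> {v. r < \<bar>v\<bar>}"
      using u by (intro eventually_nhds_in_open) auto
    then have "\<forall>\<^sub>F v in nhds u. \<phi> v = (\<lambda>_. 0) v"
      by eventually_elim (use z in auto)
    then have "deriv \<phi> u = deriv (\<lambda>_. 0) u" by (rule deriv_cong_ev) simp
    then show ?thesis by simp
  qed
  with z show ?thesis by (rule that)
qed

text \<open>
  Integration by parts in disguise: \<open>- \<phi> (X \<omega>)\<close> is the integral of \<open>\<phi>'\<close> over the half-line from
  \<open>X \<omega>\<close>, because \<open>\<phi>\<close> vanishes far out, and integrating this over \<open>\<omega>\<close> first replaces the indicator of
  \<open>X \<omega> \<le> u\<close> by its probability.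
\<close>

lemma cdf_has_distributional_derivative:
  assumes "prob_space M" and X [measurable]: "X \<in> borel_measurable M"
  shows "has_distributional_derivative (\<lambda>u. measure M {\<omega> \<in> space M. X \<omega> \<le> u})
           (\<lambda>\<phi>. \<integral>\<omega>. \<phi> (X \<omega>) \<partial>M)"
  unfolding has_distributional_derivative_def
proof (intro allI impI)
  fix \<phi> :: "real \<Rightarrow> real" assume tf: "test_function \<phi>"
  interpret prob_space M by fact
  interpret P: pair_sigma_finite M lborel ..
  note D = test_function_derivative(1)[OF tf]
  note cont = test_function_derivative(2)[OF tf]
  obtain r where r: "\<And>u. r < \<bar>u\<bar> \<Longrightarrow> \<phi> u = 0" "\<And>u. r < \<bar>u\<bar> \<Longrightarrow> deriv \<phi> u = 0"
    using test_function_support[OF tf] by blast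
  have [measurable]: "deriv \<phi> \<in> borel_measurable borel"
    using cont by (rule borel_measurable_continuous_onI)
  have "integrable lborel (\<lambda>u. indicator {-r..r} u *\<^sub>R deriv \<phi> u)"
    using continuous_on_subset[OF cont, of "{-r..r}"]
    by (intro borel_integrable_compact) auto
  also have "(\<lambda>u. indicator {-r..r} u *\<^sub>R deriv \<phi> u) = deriv \<phi>"
    using r(2) by (force simp: fun_eq_iff indicator_def)
  finally have int: "integrable lborel (deriv \<phi>)" .
  let ?g = "\<lambda>\<omega> u. indicator {X \<omega>..} u * deriv \<phi> u"
  have inner: "(\<integral>u. ?g \<omega> u \<partial>lborel) = - \<phi> (X \<omega>)" for \<omega>
  proof -
    \<comment> \<open>a point to the right of both \<open>X \<omega>\<close> and the support of \<open>\<phi>\<close>\<close>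
    let ?q = "max (X \<omega>) (r + 1)"
    have "has_bochner_integral lborel (\<lambda>u. deriv \<phi> u * indicator {X \<omega>..?q} u) (\<phi> ?q - \<phi> (X \<omega>))"
      using D cont by (intro has_bochner_integral_FTC_Icc_real) (auto simp: continuous_on_eq_continuous_at)
    moreover have "(\<lambda>u. deriv \<phi> u * indicator {X \<omega>..?q} u) = ?g \<omega>"
      using r(2) by (auto simp: fun_eq_iff indicator_def)
    moreover have "\<phi> ?q = 0" using r(1) by auto
    ultimately show ?thesis by (simp add: has_bochner_integral_iff)
  qed
  have gint: "integrable lborel (?g \<omega>)" for \<omega>
    using integrable_mult_indicator[OF _ int, of "{X \<omega>..}"] by simp
  have [measurable]: "(\<lambda>(\<omega>, u). ?g \<omega> u) \<in> borel_measurable (M \<Otimes>\<^sub>M lborel)"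
  proof -
    have "(\<lambda>(\<omega>, u). ?g \<omega> u) = (\<lambda>p. (if X (fst p) \<le> snd p then 1 else 0) * deriv \<phi> (snd p))"
      by (auto simp: fun_eq_iff indicator_def)
    then show ?thesis by simp
  qed
  have "integrable (M \<Otimes>\<^sub>M lborel) (\<lambda>(\<omega>, u). ?g \<omega> u)"
  proof (rule P.Fubini_integrable)
    have "(\<lambda>\<omega>. \<integral>u. norm (?g \<omega> u) \<partial>lborel) \<in> borel_measurable M" by measurable
    moreover have "norm (\<integral>u. norm (?g \<omega> u) \<partial>lborel) \<le> (\<integral>u. \<bar>deriv \<phi> u\<bar> \<partial>lborel)" for \<omega>
    proof -
      have "(\<integral>u. norm (?g \<omega> u) \<partial>lborel) \<le> (\<integral>u. \<bar>deriv \<phi> u\<bar> \<partial>lborel)"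
        using gint int by (intro integral_mono) (auto simp: indicator_def)
      then show ?thesis by simp
    qed
    ultimately show "integrable M (\<lambda>\<omega>. \<integral>u. norm (case (\<omega>, u) of (\<omega>, u) \<Rightarrow> ?g \<omega> u) \<partial>lborel)"
      by (intro integrable_const_bound) auto
  qed (use gint in auto)
  from P.Fubini_integral[OF this]
  have swap: "(\<integral>u. \<integral>\<omega>. ?g \<omega> u \<partial>M \<partial>lborel) = (\<integral>\<omega>. - \<phi> (X \<omega>) \<partial>M)"
    by (simp only: inner)
  have outer: "(\<integral>\<omega>. ?g \<omega> u \<partial>M) = measure M {\<omega> \<in> space M. X \<omega> \<le> u} * deriv \<phi> u" for u
  proof -
    have "(\<integral>\<omega>. ?g \<omega> u \<partial>M) = (\<integral>\<omega>. indicator {\<omega> \<in> space M. X \<omega> \<le> u} \<omega> * deriv \<phi> u \<partial>M)"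
      by (intro Bochner_Integration.integral_cong) (auto simp: indicator_def)
    then show ?thesis by (simp add: Int_absorb2 Collect_conj_eq)
  qed
  show "(\<integral>\<omega>. \<phi> (X \<omega>) \<partial>M) =
      - (\<integral>u. measure M {\<omega> \<in> space M. X \<omega> \<le> u} * deriv \<phi> u \<partial>lborel)"
    using swap by (simp only: outer) simp
qed

section \<open>Laws with an atom at zero under reflected steps\<close>

text \<open>
  The law of \<open>X\<close> is \<open>c\<close> times the unit mass at \<open>0\<close> plus the density \<open>p\<close>. Testing against bounded
  functions, rather than comparing measures, makes the condition linear in \<open>c\<close> and \<open>p\<close>, so that signed
  explicit formulas for \<open>p\<close> can be inserted term by term.
\<close>

definition mixed_law :: "'a measure \<Rightarrow> ('a \<Rightarrow> real) \<Rightarrow> real \<Rightarrow> (real \<Rightarrow> real) \<Rightarrow> bool" where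
  "mixed_law M X c p \<longleftrightarrow> integrable lborel p \<and>
     (\<forall>h C. h \<in> borel_measurable borel \<longrightarrow> (\<forall>u. \<bar>h u\<bar> \<le> C) \<longrightarrow>
        (\<integral>\<omega>. h (X \<omega>) \<partial>M) = c * h 0 + (\<integral>y. p y * h y \<partial>lborel))"

lemma mixed_law_expectation:
  assumes "mixed_law M X c p" and "h \<in> borel_measurable borel" and "\<And>u. \<bar>h u\<bar> \<le> C"
  shows "(\<integral>\<omega>. h (X \<omega>) \<partial>M) = c * h 0 + (\<integral>y. p y * h y \<partial>lborel)"
  using assms unfolding mixed_law_def by blast

lemma integrable_mult_bounded:
  fixes f g :: "real \<Rightarrow> real"
  assumes "integrable lborel f" and [measurable]: "g \<in> borel_measurable borel" and "\<And>u. \<bar>g u\<bar> \<le> C"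
  shows "integrable lborel (\<lambda>u. f u * g u)"
proof (rule Bochner_Integration.integrable_bound)
  show "integrable lborel (\<lambda>u. C * f u)" using assms(1) by simp
  show "(\<lambda>u. f u * g u) \<in> borel_measurable lborel" using assms(1) by measurable
  have "norm (f u * g u) \<le> norm (C * f u)" for u
  proof -
    have "\<bar>f u\<bar> * \<bar>g u\<bar> \<le> \<bar>f u\<bar> * C" using assms(3)[of u] by (intro mult_left_mono) auto
    moreover have "C \<ge> 0" using assms(3)[of u] by linarith
    ultimately show ?thesis by (simp add: abs_mult mult.commute)
  qed
  then show "AE u in lborel. norm (f u * g u) \<le> norm (C * f u)" by simp
qed

lemma lborel_integral_shift:
  fixes f :: "real \<Rightarrow> real"
  shows "(\<integral>u. f (u + t) \<partial>lborel) = (\<integral>u. f u \<partial>lborel)"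
  using lborel_integral_real_affine[of 1 f t] by (simp add: add.commute)

text \<open>
  The part of the increment that would lead below \<open>0\<close> contributes the value of \<open>h\<close> at the barrier;
  on the rest, \<open>u = w + z\<close> is substituted.
\<close>

lemma reflected_step_expectation:
  fixes f h :: "real \<Rightarrow> real"
  assumes f: "integrable lborel f"
    and h [measurable]: "h \<in> borel_measurable borel" and bd: "\<And>u. \<bar>h u\<bar> \<le> C"
  shows "(\<integral>z. f z * h (max 0 (w + z)) \<partial>lborel) =
      h 0 * (\<integral>z. f z * indicator {..- w} z \<partial>lborel)
      + (\<integral>u. indicator {0<..} u * h u * f (u - w) \<partial>lborel)"
proof -
  have [measurable]: "f \<in> borel_measurable borel" using f by simp
  have C: "0 \<le> C" using bd[of 0] by linarith
  have i1: "integrable lborel (\<lambda>z. f z * (h 0 * indicator {..- w} z))"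
    using f bd[of 0] C by (intro integrable_mult_bounded[where C=C]) (auto simp: indicator_def)
  have i2: "integrable lborel (\<lambda>z. f z * (indicator {-w<..} z * h (w + z)))"
    using f bd C by (intro integrable_mult_bounded[where C=C]) (auto simp: indicator_def)
  have "(\<integral>z. f z * h (max 0 (w + z)) \<partial>lborel) =
     (\<integral>z. f z * (h 0 * indicator {..- w} z) + f z * (indicator {-w<..} z * h (w + z)) \<partial>lborel)"
  proof (rule Bochner_Integration.integral_cong)
    show "f z * h (max 0 (w + z)) = f z * (h 0 * indicator {..- w} z) + f z * (indicator {-w<..} z * h (w + z))" for z
      by (cases "z \<le> - w") (auto simp: max_absorb1 max_absorb2)
  qed simp
  also have "\<dots> = (\<integral>z. f z * (h 0 * indicator {..- w} z) \<partial>lborel) +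
      (\<integral>z. f z * (indicator {-w<..} z * h (w + z)) \<partial>lborel)"
    by (rule Bochner_Integration.integral_add[OF i1 i2])
  also have "(\<integral>z. f z * (h 0 * indicator {..- w} z) \<partial>lborel) = h 0 * (\<integral>z. f z * indicator {..- w} z \<partial>lborel)"
    by (simp only: mult.left_commute[of _ "h 0"] integral_mult_right_zero)
  also have "(\<integral>z. f z * (indicator {-w<..} z * h (w + z)) \<partial>lborel)
      = (\<integral>z. (\<lambda>u. indicator {0<..} u * h u * f (u - w)) (z + w) \<partial>lborel)"
    by (intro Bochner_Integration.integral_cong) (auto simp: indicator_def add.commute)
  also have "\<dots> = (\<integral>u. indicator {0<..} u * h u * f (u - w) \<partial>lborel)"
    by (rule lborel_integral_shift)
  finally show ?thesis .
qed

lemma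
  fixes p f h :: "real \<Rightarrow> real"
  assumes p: "integrable lborel p" and f: "integrable lborel f"
    and h [measurable]: "h \<in> borel_measurable borel" and bd: "\<And>u. \<bar>h u\<bar> \<le> C"
  shows integral_convolution_swap:
      "(\<integral>w. p w * (\<integral>u. h u * f (u - w) \<partial>lborel) \<partial>lborel) =
       (\<integral>u. h u * (\<integral>w. p w * f (u - w) \<partial>lborel) \<partial>lborel)"
    and integrable_convolution:
      "integrable lborel (\<lambda>u. h u * (\<integral>w. p w * f (u - w) \<partial>lborel))"
proof -
  have [measurable]: "p \<in> borel_measurable borel" "f \<in> borel_measurable borel" using p f by auto
  let ?F = "\<lambda>w u. p w * (h u * f (u - w))"
  have shift: "integrable lborel (\<lambda>u. f (u - w))" for w
    using lborel_integrable_real_affine[OF f, of 1 "- w"] by (simp add: add.commute)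
  have I: "integrable lborel (\<lambda>u. h u * f (u - w))" for w
    using integrable_mult_bounded[OF shift h bd] by (simp add: mult.commute)
  have "integrable (lborel \<Otimes>\<^sub>M lborel) (\<lambda>(w, u). ?F w u)"
  proof (rule lborel_pair.Fubini_integrable)
    show "integrable lborel (\<lambda>w. \<integral>u. norm (case (w, u) of (w, u) \<Rightarrow> ?F w u) \<partial>lborel)"
    proof (rule Bochner_Integration.integrable_bound)
      show "integrable lborel (\<lambda>w. (C * (\<integral>u. \<bar>f u\<bar> \<partial>lborel)) * p w)" using p by simp
      have "norm (\<integral>u. norm (?F w u) \<partial>lborel) \<le> norm ((C * (\<integral>u. \<bar>f u\<bar> \<partial>lborel)) * p w)" for w
      proof -
        have C: "0 \<le> C" using bd[of 0] by linarith
        have "(\<integral>u. norm (?F w u) \<partial>lborel) = \<bar>p w\<bar> * (\<integral>u. \<bar>h u * f (u - w)\<bar> \<partial>lborel)"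
          by (simp add: abs_mult)
        also have "\<dots> \<le> \<bar>p w\<bar> * (\<integral>u. C * \<bar>f (u - w)\<bar> \<partial>lborel)"
        proof (rule mult_left_mono)
          show "(\<integral>u. \<bar>h u * f (u - w)\<bar> \<partial>lborel) \<le> (\<integral>u. C * \<bar>f (u - w)\<bar> \<partial>lborel)"
          proof (rule integral_mono)
            show "integrable lborel (\<lambda>u. \<bar>h u * f (u - w)\<bar>)" using I[of w] by (rule integrable_abs)
            show "integrable lborel (\<lambda>u. C * \<bar>f (u - w)\<bar>)"
              using shift[of w] by simp
          qed (auto simp: abs_mult intro!: mult_right_mono bd)
        qed simp
        also have "(\<integral>u. C * \<bar>f (u - w)\<bar> \<partial>lborel) = C * (\<integral>u. \<bar>f u\<bar> \<partial>lborel)"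
          using lborel_integral_shift[of "\<lambda>u. \<bar>f u\<bar>" "- w"] by simp
        finally show ?thesis using C by (simp add: abs_mult mult.commute)
      qed
      then show "AE w in lborel. norm (\<integral>u. norm (case (w, u) of (w, u) \<Rightarrow> ?F w u) \<partial>lborel)
          \<le> norm ((C * (\<integral>u. \<bar>f u\<bar> \<partial>lborel)) * p w)" by simp
    qed measurable
    show "AE w in lborel. integrable lborel (\<lambda>u. case (w, u) of (w, u) \<Rightarrow> ?F w u)"
      using I by (intro AE_I2) (auto intro: integrable_mult_right)
  qed measurable
  note sw = lborel_pair.Fubini_integral[OF this] and isn = lborel_pair.integrable_snd[OF this]
  have eq: "(\<integral>w. ?F w u \<partial>lborel) = h u * (\<integral>w. p w * f (u - w) \<partial>lborel)" for u
    by (simp add: mult.left_commute)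
  show "(\<integral>w. p w * (\<integral>u. h u * f (u - w) \<partial>lborel) \<partial>lborel) =
       (\<integral>u. h u * (\<integral>w. p w * f (u - w) \<partial>lborel) \<partial>lborel)"
    using sw by (simp add: eq)
  show "integrable lborel (\<lambda>u. h u * (\<integral>w. p w * f (u - w) \<partial>lborel))"
    using isn by (simp add: eq)
qed

lemma mixed_law_initial_step:
  assumes Y: "distributed M lborel Y (\<lambda>z. ennreal (f z))" and nn: "\<And>z. 0 \<le> f z"
    and f: "integrable lborel f"
  shows "mixed_law M (\<lambda>\<omega>. max 0 (x + Y \<omega>)) (\<integral>z. f z * indicator {..- x} z \<partial>lborel)
           (\<lambda>u. indicator {0<..} u * f (u - x))"
  unfolding mixed_law_def
proof (intro conjI allI impI)
  have sh: "integrable lborel (\<lambda>u. f (u - x))"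
    using lborel_integrable_real_affine[OF f, of 1 "- x"] by (simp add: add.commute)
  then show "integrable lborel (\<lambda>u. indicator {0<..} u * f (u - x))"
    using integrable_mult_bounded[OF sh, of "indicator {0<..}" 1] by (simp add: mult.commute)
  fix h :: "real \<Rightarrow> real" and C
  assume h [measurable]: "h \<in> borel_measurable borel" and bd: "\<forall>u. \<bar>h u\<bar> \<le> C"
  have "(\<integral>\<omega>. h (max 0 (x + Y \<omega>)) \<partial>M) = (\<integral>z. f z * h (max 0 (x + z)) \<partial>lborel)"
    by (rule distributed_integral[OF Y _ nn, symmetric]) simp
  also note reflected_step_expectation[OF f h, of C x]
  finally show "(\<integral>\<omega>. h (max 0 (x + Y \<omega>)) \<partial>M) =
      (\<integral>z. f z * indicator {..- x} z \<partial>lborel) * h 0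
      + (\<integral>u. indicator {0<..} u * f (u - x) * h u \<partial>lborel)"
    using bd by (simp add: mult_ac)
qed

text \<open>
  By independence the joint law is a product, so the increment can be integrated out first.
\<close>

lemma expectation_step_independent:
  fixes h f :: "real \<Rightarrow> real"
  assumes "prob_space M" and ind: "prob_space.indep_var M borel X borel Y"
    and Y: "distributed M lborel Y (\<lambda>z. ennreal (f z))" and nn: "\<And>z. 0 \<le> f z"
    and f [measurable]: "f \<in> borel_measurable borel"
    and h [measurable]: "h \<in> borel_measurable borel" and bd: "\<And>u. \<bar>h u\<bar> \<le> C"
  shows "(\<integral>\<omega>. h (max 0 (X \<omega> + Y \<omega>)) \<partial>M) =
         (\<integral>\<omega>. (\<integral>z. f z * h (max 0 (X \<omega> + z)) \<partial>lborel) \<partial>M)"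
proof -
  interpret prob_space M by fact
  note iv = ind[unfolded indep_var_distribution_eq]
  have [measurable]: "X \<in> borel_measurable M" "Y \<in> borel_measurable M" using iv by auto
  interpret X: prob_space "distr M borel X" by (rule prob_space_distr) simp
  interpret Y: prob_space "distr M borel Y" by (rule prob_space_distr) simp
  interpret P: pair_prob_space "distr M borel X" "distr M borel Y" ..
  let ?g = "\<lambda>p. h (max 0 (fst p + snd p))"
  have gm: "?g \<in> borel_measurable (borel \<Otimes>\<^sub>M borel)" by measurable
  have gi: "integrable (distr M borel X \<Otimes>\<^sub>M distr M borel Y) ?g"
    by (rule P.integrable_const_bound[where B=C]) (use bd gm in auto)
  have "(\<integral>\<omega>. h (max 0 (X \<omega> + Y \<omega>)) \<partial>M) =
      (\<integral>p. ?g p \<partial>distr M (borel \<Otimes>\<^sub>M borel) (\<lambda>\<omega>. (X \<omega>, Y \<omega>)))"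
    by (subst integral_distr) (use gm in auto)
  also have "\<dots> = (\<integral>p. ?g p \<partial>(distr M borel X \<Otimes>\<^sub>M distr M borel Y))" using iv by simp
  also have "\<dots> = (\<integral>w. \<integral>z. h (max 0 (w + z)) \<partial>distr M borel Y \<partial>distr M borel X)"
    using P.integral_fst'[OF gi] by simp
  also have "\<dots> = (\<integral>w. \<integral>z. f z * h (max 0 (w + z)) \<partial>lborel \<partial>distr M borel X)"
  proof (rule Bochner_Integration.integral_cong)
    fix w
    have "(\<integral>z. h (max 0 (w + z)) \<partial>distr M borel Y) = (\<integral>\<omega>. h (max 0 (w + Y \<omega>)) \<partial>M)"
      by (rule integral_distr) auto
    also have "\<dots> = (\<integral>z. f z * h (max 0 (w + z)) \<partial>lborel)"
      by (rule distributed_integral[OF Y _ nn, symmetric]) simp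
    finally show "(\<integral>z. h (max 0 (w + z)) \<partial>distr M borel Y) = (\<integral>z. f z * h (max 0 (w + z)) \<partial>lborel)" .
  qed simp
  also have "\<dots> = (\<integral>\<omega>. (\<integral>z. f z * h (max 0 (X \<omega> + z)) \<partial>lborel) \<partial>M)"
    by (rule integral_distr) auto
  finally show ?thesis .
qed

text \<open>
  Conditioning on \<open>X\<close> replaces \<open>h\<close> by a bounded function of \<open>X\<close>, to which the law of \<open>X\<close> applies;
  Fubini then moves the integral over the new position outside.
\<close>

lemma mixed_law_step:
  assumes "prob_space M" and ind: "prob_space.indep_var M borel X borel Y"
    and Y: "distributed M lborel Y (\<lambda>z. ennreal (f z))" and nn: "\<And>z. 0 \<le> f z"
    and f: "integrable lborel f" and X: "mixed_law M X c p"
  defines "F \<equiv> \<lambda>w. \<integral>z. f z * indicator {..- w} z \<partial>lborel"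
  shows "mixed_law M (\<lambda>\<omega>. max 0 (X \<omega> + Y \<omega>))
           (c * F 0 + (\<integral>w. p w * F w \<partial>lborel))
           (\<lambda>u. indicator {0<..} u * (c * f u + (\<integral>w. p w * f (u - w) \<partial>lborel)))"
  unfolding mixed_law_def
proof (intro conjI allI impI)
  have [measurable]: "f \<in> borel_measurable borel" using f by simp
  have p: "integrable lborel p" using X by (simp add: mixed_law_def)
  have i1: "integrable lborel (\<lambda>u. c * f u * g u)"
    if "g \<in> borel_measurable borel" "\<And>u. \<bar>g u\<bar> \<le> C" for g C
    using integrable_mult_right[OF integrable_mult_bounded[OF f that], of c] by (simp add: mult_ac)
  note i2 = integrable_convolution[OF p f]
  have "integrable lborel (\<lambda>u. c * f u * indicator {0<..} u + indicator {0<..} u * (\<integral>w. p w * f (u - w) \<partial>lborel))"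
    by (intro Bochner_Integration.integrable_add i1[where C=1] i2[where C=1]) (auto simp: indicator_def)
  then show "integrable lborel (\<lambda>u. indicator {0<..} u * (c * f u + (\<integral>w. p w * f (u - w) \<partial>lborel)))"
    by (simp add: algebra_simps)
  fix h :: "real \<Rightarrow> real" and C
  assume h [measurable]: "h \<in> borel_measurable borel" and "\<forall>u. \<bar>h u\<bar> \<le> C"
  then have bd: "\<bar>h u\<bar> \<le> C" for u by simp
  then have C: "0 \<le> C" using bd[of 0] by linarith
  let ?h = "\<lambda>u. indicator {0<..} u * h u"
  have bd': "\<bar>?h u\<bar> \<le> C" for u using bd C by (simp add: indicator_def)
  let ?m = "\<integral>z. \<bar>f z\<bar> \<partial>lborel"
  let ?K = "\<lambda>w. \<integral>z. f z * h (max 0 (w + z)) \<partial>lborel"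
  have Keq: "?K w = h 0 * F w + (\<integral>u. ?h u * f (u - w) \<partial>lborel)" for w
    unfolding F_def by (rule reflected_step_expectation[OF f h bd])
  have [measurable]: "F \<in> borel_measurable borel"
  proof -
    have "F = (\<lambda>w. \<integral>z. f z * (if w + z \<le> 0 then 1 else 0) \<partial>lborel)"
      unfolding F_def by (intro ext Bochner_Integration.integral_cong) (auto simp: indicator_def)
    then show ?thesis by simp
  qed
  have bint: "\<bar>\<integral>z. f z * g z \<partial>lborel\<bar> \<le> D * ?m"
    if g [measurable]: "g \<in> borel_measurable borel" and gb: "\<And>z. \<bar>g z\<bar> \<le> D" for g :: "real \<Rightarrow> real" and D
  proof -
    have fg: "\<bar>f z\<bar> * \<bar>g z\<bar> \<le> D * \<bar>f z\<bar>" for z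
      using mult_right_mono[OF gb[of z], of "\<bar>f z\<bar>"] by (simp add: mult.commute)
    have "\<bar>\<integral>z. f z * g z \<partial>lborel\<bar> \<le> (\<integral>z. D * \<bar>f z\<bar> \<partial>lborel)"
      using integrable_mult_bounded[OF f g gb] f
      by (intro order_trans[OF integral_abs_bound] integral_mono integrable_mult_right integrable_abs)
         (auto simp: abs_mult fg)
    then show ?thesis by simp
  qed
  have Fb: "\<bar>F w\<bar> \<le> 1 * ?m" for w unfolding F_def by (rule bint) (auto simp: indicator_def)
  have Kb: "\<bar>?K w\<bar> \<le> C * ?m" for w by (rule bint) (use bd in auto)
  have [measurable]: "?K \<in> borel_measurable borel" by measurable
  have pF: "integrable lborel (\<lambda>w. p w * F w)"
    by (rule integrable_mult_bounded[OF p _ Fb]) simp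
  have pK: "integrable lborel (\<lambda>w. p w * ?K w)"
    by (rule integrable_mult_bounded[OF p _ Kb]) simp
  have "(\<lambda>w. p w * (\<integral>u. ?h u * f (u - w) \<partial>lborel)) = (\<lambda>w. p w * ?K w - h 0 * (p w * F w))"
    by (simp only: Keq) (simp add: algebra_simps)
  then have pc: "integrable lborel (\<lambda>w. p w * (\<integral>u. ?h u * f (u - w) \<partial>lborel))"
    using pK pF by simp
  have "(\<integral>\<omega>. h (max 0 (X \<omega> + Y \<omega>)) \<partial>M) = (\<integral>\<omega>. ?K (X \<omega>) \<partial>M)"
    by (rule expectation_step_independent[OF assms(1) ind Y nn _ h bd]) simp
  also have "\<dots> = c * ?K 0 + (\<integral>w. p w * ?K w \<partial>lborel)"
    by (rule mixed_law_expectation[OF X _ Kb]) simp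
  also have "(\<integral>w. p w * ?K w \<partial>lborel) =
      (\<integral>w. h 0 * (p w * F w) + p w * (\<integral>u. ?h u * f (u - w) \<partial>lborel) \<partial>lborel)"
    by (simp only: Keq) (simp add: algebra_simps)
  also have "\<dots> = h 0 * (\<integral>w. p w * F w \<partial>lborel) + (\<integral>w. p w * (\<integral>u. ?h u * f (u - w) \<partial>lborel) \<partial>lborel)"
    using pF pc by simp
  also have "(\<integral>w. p w * (\<integral>u. ?h u * f (u - w) \<partial>lborel) \<partial>lborel) =
      (\<integral>u. ?h u * (\<integral>w. p w * f (u - w) \<partial>lborel) \<partial>lborel)"
    by (rule integral_convolution_swap[OF p f _ bd']) simp
  also have "?K 0 = h 0 * F 0 + (\<integral>u. ?h u * f u \<partial>lborel)" using Keq[of 0] by simp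
  finally have "(\<integral>\<omega>. h (max 0 (X \<omega> + Y \<omega>)) \<partial>M) =
      (c * F 0 + (\<integral>w. p w * F w \<partial>lborel)) * h 0
      + ((\<integral>u. c * (?h u * f u) \<partial>lborel) + (\<integral>u. ?h u * (\<integral>w. p w * f (u - w) \<partial>lborel) \<partial>lborel))"
    by (simp add: algebra_simps)
  also have "(\<integral>u. c * (?h u * f u) \<partial>lborel) + (\<integral>u. ?h u * (\<integral>w. p w * f (u - w) \<partial>lborel) \<partial>lborel) =
     (\<integral>u. c * (?h u * f u) + ?h u * (\<integral>w. p w * f (u - w) \<partial>lborel) \<partial>lborel)"
  proof (rule Bochner_Integration.integral_add[symmetric])
    show "integrable lborel (\<lambda>u. c * (?h u * f u))"
      using i1[of ?h C] bd' by (simp add: mult_ac)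
    show "integrable lborel (\<lambda>u. ?h u * (\<integral>w. p w * f (u - w) \<partial>lborel))"
      by (rule i2[OF _ bd']) simp
  qed
  also have "\<dots> = (\<integral>u. indicator {0<..} u * (c * f u + (\<integral>w. p w * f (u - w) \<partial>lborel)) * h u \<partial>lborel)"
    by (simp add: algebra_simps)
  finally show "(\<integral>\<omega>. h (max 0 (X \<omega> + Y \<omega>)) \<partial>M) =
      (c * F 0 + (\<integral>w. p w * F w \<partial>lborel)) * h 0
      + (\<integral>u. indicator {0<..} u * (c * f u + (\<integral>w. p w * f (u - w) \<partial>lborel)) * h u \<partial>lborel)" .
qed

section \<open>Independence of the Lindley process and the next increment\<close>

text \<open>
  The recursion can be run on the space of increment sequences itself; this exhibits \<open>W\<^sub>n\<close> as a
  measurable function of the vector of its first \<open>n\<close> increments.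
\<close>

lemma lindley_restrict:
  assumes "{1..n} \<subseteq> A"
  shows "lindley x (\<lambda>i \<rho>. \<rho> i) n (\<lambda>i\<in>A. Z i \<omega>) = lindley x Z n \<omega>"
  using assms
proof (induction n)
  case (Suc n)
  then have "{1..n} \<subseteq> A" "Suc n \<in> A" by force+
  with Suc.IH show ?case by simp
qed simp

lemma measurable_lindley_coordinates:
  assumes "{1..n} \<subseteq> A"
  shows "lindley x (\<lambda>i \<rho>. \<rho> i) n \<in> borel_measurable (\<Pi>\<^sub>M i\<in>A. borel)"
  using assms
proof (induction n)
  case (Suc n)
  then have "{1..n} \<subseteq> A" by force
  with Suc.IH have [measurable]: "lindley x (\<lambda>i \<rho>. \<rho> i) n \<in> borel_measurable (\<Pi>\<^sub>M i\<in>A. borel)" .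
  have [measurable]: "(\<lambda>\<rho>. \<rho> (Suc n)) \<in> borel_measurable (\<Pi>\<^sub>M i\<in>A. borel)"
    using Suc.prems by (intro measurable_component_singleton) auto
  have "lindley x (\<lambda>i \<rho>. \<rho> i) (Suc n) = (\<lambda>\<rho>. max 0 (lindley x (\<lambda>i \<rho>. \<rho> i) n \<rho> + \<rho> (Suc n)))"
    by (simp add: fun_eq_iff)
  then show ?case by simp
next
  case 0
  have "lindley x (\<lambda>i \<rho>. \<rho> i) 0 = (\<lambda>_. x)" by (simp add: fun_eq_iff)
  then show ?case by simp
qed

lemma lindley_indep_next_increment:
  assumes "prob_space M" and "prob_space.indep_vars M (\<lambda>_. borel) Z {1..}"
  shows "prob_space.indep_var M borel (lindley x Z n) borel (Z (Suc n))"
proof -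
  interpret prob_space M by fact
  have "indep_var (\<Pi>\<^sub>M i\<in>{1..n}. borel) (\<lambda>\<omega>. \<lambda>i\<in>{1..n}. Z i \<omega>) (\<Pi>\<^sub>M i\<in>{Suc n}. borel) (\<lambda>\<omega>. \<lambda>i\<in>{Suc n}. Z i \<omega>)"
    by (rule indep_var_restrict[OF assms(2)]) auto
  then have "indep_var borel (lindley x (\<lambda>i \<rho>. \<rho> i) n \<circ> (\<lambda>\<omega>. \<lambda>i\<in>{1..n}. Z i \<omega>))
       borel ((\<lambda>\<rho>. \<rho> (Suc n)) \<circ> (\<lambda>\<omega>. \<lambda>i\<in>{Suc n}. Z i \<omega>))"
    by (rule indep_var_compose) (auto intro!: measurable_lindley_coordinates measurable_component_singleton)
  then show ?thesis by (simp add: comp_def lindley_restrict)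
qed


section \<open>Incomplete Gamma functions as antiderivatives\<close>

text \<open>
  This is \<open>k!\<close> times the Taylor polynomial of \<open>exp\<close> of degree \<open>k\<close>, and the polynomial factor of
  \<open>\<Gamma>(k + 1, t)\<close>; see \<open>inc_Gamma_eq_exp_poly\<close>.
\<close>

definition exp_poly :: "nat \<Rightarrow> real \<Rightarrow> real" where
  "exp_poly k t = (\<Sum>j\<le>k. fact k / fact j * t ^ j)"

lemma exp_poly_Suc: "exp_poly (Suc k) t = t ^ Suc k + real (Suc k) * exp_poly k t"
  by (simp add: exp_poly_def sum_distrib_left mult_ac)

lemma exp_poly_nonneg: "0 \<le> t \<Longrightarrow> 0 \<le> exp_poly k t"
  by (simp add: exp_poly_def sum_nonneg)

lemma DERIV_exp_poly: "(exp_poly k has_real_derivative exp_poly k t - t ^ k) (at t)"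
proof (induction k)
  case 0
  then show ?case by (simp add: exp_poly_def)
next
  case (Suc k)
  have "((\<lambda>t. t ^ Suc k + real (Suc k) * exp_poly k t) has_real_derivative
      real (Suc k) * t ^ k + real (Suc k) * (exp_poly k t - t ^ k)) (at t)"
  proof -
    have "((\<lambda>t. t ^ Suc k) has_real_derivative real (Suc k) * t ^ k) (at t)"
      using DERIV_pow[of "Suc k" t] by simp
    then show ?thesis using Suc by (intro DERIV_add DERIV_cmult)
  qed
  then show ?case by (simp add: exp_poly_Suc[abs_def] algebra_simps)
qed

lemma DERIV_exp_poly_decay:
  "((\<lambda>t. - exp (- t) * exp_poly k t) has_real_derivative t ^ k * exp (- t)) (at t)"
  by (auto intro!: derivative_eq_intros DERIV_exp_poly simp: algebra_simps)

lemma exp_poly_decay_tendsto: "((\<lambda>t. - exp (- t) * exp_poly k t) \<longlongrightarrow> 0) at_top"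
proof -
  have "((\<lambda>t. - (\<Sum>j\<le>k. fact k / fact j * (t ^ j / exp t))) \<longlongrightarrow> - (\<Sum>j\<le>k. fact k / fact j * (0::real))) at_top"
    by (intro tendsto_intros tendsto_power_div_exp_0)
  then show ?thesis
    by (simp add: exp_poly_def sum_distrib_left exp_minus divide_simps sum_negf mult_ac)
qed

text \<open>
  For \<open>y \<ge> 0\<close> the integrand is nonnegative and the fundamental theorem applies on the whole half-line.
  For \<open>y < 0\<close>, where \<open>t ^ k\<close> may be negative, the interval \<open>[y, 0]\<close> is split off.
\<close>

lemma has_integral_inc_Gamma:
  "has_bochner_integral lborel (\<lambda>t. indicator {y..} t * (t ^ k * exp (- t))) (exp (- y) * exp_poly k y)"
proof -
  let ?f = "\<lambda>t. t ^ k * exp (- t)" and ?F = "\<lambda>t. - exp (- t) * exp_poly k t"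
  have tail: "has_bochner_integral lborel (\<lambda>t. ?f t * indicator {z..} t) (0 - ?F z)" if "0 \<le> z" for z
  proof (rule has_bochner_integral_nn_integral)
    have "(\<integral>\<^sup>+t\<in>{z..}. ennreal (?f t) \<partial>lborel) = ennreal (0 - ?F z)"
      using that by (intro nn_integral_FTC_atLeast DERIV_exp_poly_decay exp_poly_decay_tendsto) auto
    then show "(\<integral>\<^sup>+t. ennreal (?f t * indicator {z..} t) \<partial>lborel) = ennreal (0 - ?F z)"
      by (simp only: nn_integral_set_ennreal)
  qed (use that exp_poly_nonneg in \<open>auto simp: indicator_def\<close>)
  show ?thesis
  proof (cases "0 \<le> y")
    case True
    then show ?thesis using tail[OF True] by (simp add: mult.commute)
  next
    case False
    have "has_bochner_integral lborel (\<lambda>t. ?f t * indicator {y..0} t) (?F 0 - ?F y)"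
      using False by (intro has_bochner_integral_FTC_Icc_real DERIV_exp_poly_decay) auto
    from has_bochner_integral_add[OF this tail[of 0]]
    have "has_bochner_integral lborel (\<lambda>t. ?f t * indicator {y..0} t + ?f t * indicator {0..} t) (0 - ?F y)"
      by simp
    also have "?this \<longleftrightarrow> has_bochner_integral lborel (\<lambda>t. indicator {y..} t * (t ^ k * exp (- t))) (0 - ?F y)"
    proof (rule has_bochner_integral_cong_AE)
      show "AE t in lborel. ?f t * indicator {y..0} t + ?f t * indicator {0..} t = indicator {y..} t * ?f t"
        using AE_lborel_singleton[of 0] by eventually_elim (use False in \<open>auto simp: indicator_def\<close>)
    qed auto
    finally show ?thesis by simp
  qed
qed

lemma inc_Gamma_eq_exp_poly: "inc_Gamma (Suc k) y = exp (- y) * exp_poly k y"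
  using has_integral_inc_Gamma[of y k]
  by (simp add: inc_Gamma_def set_lebesgue_integral_def has_bochner_integral_iff)

lemma DERIV_inc_Gamma:
  assumes "(g has_real_derivative g') (at t)"
  shows "((\<lambda>t. inc_Gamma (Suc k) (g t)) has_real_derivative - (g t ^ k * exp (- g t)) * g') (at t)"
proof -
  have "((\<lambda>t. - (- exp (- t) * exp_poly k t)) has_real_derivative - (t ^ k * exp (- t))) (at t)" for t
    by (intro DERIV_minus DERIV_exp_poly_decay)
  then have "(inc_Gamma (Suc k) has_real_derivative - (t ^ k * exp (- t))) (at t)" for t
    by (simp add: inc_Gamma_eq_exp_poly[abs_def])
  from DERIV_chain2[OF this assms] show ?thesis .
qed

text \<open>
  Open intervals fit together without overlap at the breakpoints of a piecewise density.
\<close>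

lemma has_integral_Ioo_FTC:
  fixes f F :: "real \<Rightarrow> real"
  assumes "p \<le> q" and D: "\<And>x. (F has_real_derivative f x) (at x)" and c: "\<And>x. isCont f x"
  shows "has_bochner_integral lborel (\<lambda>y. indicator {p<..<q} y * f y) (eval_between F p q)"
proof -
  have [measurable]: "f \<in> borel_measurable borel"
    using c by (intro borel_measurable_continuous_onI) (simp add: continuous_at_imp_continuous_on)
  have "has_bochner_integral lborel (\<lambda>y. f y * indicator {p..q} y) (F q - F p)"
    by (rule has_bochner_integral_FTC_Icc_real[OF assms(1) D c])
  also have "?this \<longleftrightarrow> has_bochner_integral lborel (\<lambda>y. indicator {p<..<q} y * f y) (F q - F p)"
  proof (rule has_bochner_integral_cong_AE)
    show "AE y in lborel. f y * indicator {p..q} y = indicator {p<..<q} y * f y"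
      using AE_lborel_singleton[of p] AE_lborel_singleton[of q]
      by eventually_elim (auto simp: indicator_def)
  qed auto
  finally show ?thesis by (simp add: eval_between_def)
qed

lemma power_exp_inc_Gamma_derivative:
  fixes d \<gamma> :: real
  assumes "\<gamma> \<noteq> 0"
  shows "((\<lambda>y. - exp (- \<gamma> * d) / \<gamma> ^ Suc k * inc_Gamma (Suc k) (\<gamma> * (y - d)))
     has_real_derivative (y - d) ^ k * exp (- \<gamma> * y)) (at y)"
proof -
  have "exp (- \<gamma> * d) * exp (- (\<gamma> * (y - d))) = exp (- \<gamma> * y)"
    by (simp add: exp_add[symmetric] algebra_simps)
  then have "exp (- \<gamma> * d) * exp (- (\<gamma> * (y - d))) * (y - d) ^ k = (y - d) ^ k * exp (- \<gamma> * y)"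
    by (simp only: mult.commute)
  moreover have "- exp (- \<gamma> * d) / \<gamma> ^ Suc k * (- ((\<gamma> * (y - d)) ^ k * exp (- (\<gamma> * (y - d)))) * \<gamma>) =
      exp (- \<gamma> * d) * exp (- (\<gamma> * (y - d))) * (y - d) ^ k"
    using assms unfolding power_mult_distrib by (simp add: divide_simps)
  moreover have "((\<lambda>y. \<gamma> * (y - d)) has_real_derivative \<gamma>) (at y)"
    by (auto intro!: derivative_eq_intros)
  ultimately show ?thesis
    using DERIV_cmult[OF DERIV_inc_Gamma, of _ \<gamma> y "- exp (- \<gamma> * d) / \<gamma> ^ Suc k" k] by metis
qed

lemma has_integral_Ioo_power_exp:
  fixes d \<gamma> p :: real
  assumes "\<gamma> \<noteq> 0" "p \<le> q"
  shows "has_bochner_integral lborel (\<lambda>y. indicator {p<..<q} y * ((y - d) ^ k * exp (- \<gamma> * y)))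
           (exp (- \<gamma> * d) / \<gamma> ^ Suc k * (inc_Gamma (Suc k) (\<gamma> * (p - d)) - inc_Gamma (Suc k) (\<gamma> * (q - d))))"
proof -
  have "eval_between (\<lambda>y. - exp (- \<gamma> * d) / \<gamma> ^ Suc k * inc_Gamma (Suc k) (\<gamma> * (y - d))) p q =
      exp (- \<gamma> * d) / \<gamma> ^ Suc k * (inc_Gamma (Suc k) (\<gamma> * (p - d)) - inc_Gamma (Suc k) (\<gamma> * (q - d)))"
    unfolding eval_between_def by (simp add: algebra_simps)
  then show ?thesis
    using has_integral_Ioo_FTC[OF assms(2) power_exp_inc_Gamma_derivative[OF assms(1), of d k]]
    by (simp add: mult_ac)
qed

text \<open>
  The substitution \<open>t = \<gamma> (y - d)\<close> in the integral that defines the incomplete Gamma function.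
\<close>

lemma has_integral_Ioi_power_exp:
  fixes d \<gamma> p :: real
  assumes "\<gamma> > 0"
  shows "has_bochner_integral lborel (\<lambda>y. indicator {p<..} y * ((y - d) ^ k * exp (- \<gamma> * y)))
           (exp (- \<gamma> * d) / \<gamma> ^ Suc k * inc_Gamma (Suc k) (\<gamma> * (p - d)))"
proof -
  let ?g = "\<lambda>t. exp (- \<gamma> * d) / \<gamma> ^ k * (indicator {\<gamma> * (p - d)..} t * (t ^ k * exp (- t)))"
  have "has_bochner_integral lborel ?g (exp (- \<gamma> * d) / \<gamma> ^ k * inc_Gamma (Suc k) (\<gamma> * (p - d)))"
    unfolding inc_Gamma_eq_exp_poly by (intro has_bochner_integral_mult_right has_integral_inc_Gamma)
  then have "has_bochner_integral lborel (\<lambda>y. ?g (- \<gamma> * d + \<gamma> * y))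
     ((exp (- \<gamma> * d) / \<gamma> ^ k * inc_Gamma (Suc k) (\<gamma> * (p - d))) /\<^sub>R \<bar>\<gamma>\<bar>)"
    using assms by (subst lborel_has_bochner_integral_real_affine_iff[symmetric]) auto
  also have "(\<lambda>y. ?g (- \<gamma> * d + \<gamma> * y)) = (\<lambda>y. indicator {p..} y * ((y - d) ^ k * exp (- \<gamma> * y)))"
  proof
    fix y
    have "- \<gamma> * d + \<gamma> * y = \<gamma> * (y - d)" by (simp add: algebra_simps)
    moreover have "exp (- \<gamma> * d) * exp (- (\<gamma> * (y - d))) = exp (- \<gamma> * y)"
      by (simp add: exp_add[symmetric] algebra_simps)
    moreover have "exp (- \<gamma> * d) / \<gamma> ^ k * ((\<gamma> * (y - d)) ^ k * exp (- (\<gamma> * (y - d)))) =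
        (y - d) ^ k * (exp (- \<gamma> * d) * exp (- (\<gamma> * (y - d))))"
      using assms unfolding power_mult_distrib by (simp add: divide_simps)
    moreover have "indicator {\<gamma> * (p - d)..} (\<gamma> * (y - d)) = (indicator {p..} y :: real)"
      using assms by (simp add: indicator_def)
    ultimately show "?g (- \<gamma> * d + \<gamma> * y) = indicator {p..} y * ((y - d) ^ k * exp (- \<gamma> * y))"
      by (simp add: mult.left_commute)
  qed
  also have "has_bochner_integral lborel \<dots>
      ((exp (- \<gamma> * d) / \<gamma> ^ k * inc_Gamma (Suc k) (\<gamma> * (p - d))) /\<^sub>R \<bar>\<gamma>\<bar>) \<longleftrightarrow>
    has_bochner_integral lborel (\<lambda>y. indicator {p<..} y * ((y - d) ^ k * exp (- \<gamma> * y)))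
      ((exp (- \<gamma> * d) / \<gamma> ^ k * inc_Gamma (Suc k) (\<gamma> * (p - d))) /\<^sub>R \<bar>\<gamma>\<bar>)"
  proof (rule has_bochner_integral_cong_AE)
    show "AE y in lborel. indicator {p..} y * ((y - d) ^ k * exp (- \<gamma> * y)) = indicator {p<..} y * ((y - d) ^ k * exp (- \<gamma> * y))"
      using AE_lborel_singleton[of p] by eventually_elim (auto simp: indicator_def)
  qed auto
  finally show ?thesis using assms by (simp add: field_simps)
qed

lemma has_integral_Q:
  "p \<le> q \<Longrightarrow> has_bochner_integral lborel
     (\<lambda>y. indicator {p<..<q} y * (y - real n * \<mu>) ^ k) (Q \<mu> n k p q)"
  unfolding Q_def
  by (rule has_integral_Ioo_FTC) (auto intro!: derivative_eq_intros simp del: power_Suc)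

text \<open>
  The integral of \<open>(y - n \<mu>) ^ k * exp (- 2 y / \<sigma>)\<close> over \<open>y > p\<close>; the factors
  \<open>exp (- 2 n \<mu> / \<sigma>) \<sigma> ^ (k + 1) / 2 ^ (k + 1) \<Gamma>(1 + k, \<dots>)\<close> in the recursion are its values at
  \<open>p = x + n \<mu>\<close> and \<open>p = - \<mu>\<close>.
\<close>

definition weighted_tail :: "real \<Rightarrow> real \<Rightarrow> nat \<Rightarrow> nat \<Rightarrow> real \<Rightarrow> real" where
  "weighted_tail \<mu> \<sigma> n k p = exp (- 2 * real n * \<mu> / \<sigma>) * \<sigma> ^ (k + 1) / 2 ^ (k + 1) *
     inc_Gamma (1 + k) (2 * (p - real n * \<mu>) / \<sigma>)"

context
  fixes \<mu> \<sigma> :: real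
  assumes \<sigma>: "\<sigma> > 0"
begin

lemma has_integral_G:
  assumes "p \<le> q"
  shows "has_bochner_integral lborel
     (\<lambda>y. indicator {p<..<q} y * ((y - real n * \<mu>) ^ k * exp (y / \<sigma>))) (G \<mu> \<sigma> n k p q)"
proof -
  let ?\<gamma> = "- 1 / \<sigma>"
  have c: "exp (- ?\<gamma> * (real n * \<mu>)) / ?\<gamma> ^ Suc k = - (exp (real n * \<mu> / \<sigma>) * \<sigma> ^ (k + 1) * (- 1) ^ k)"
    using \<sigma> by (cases "even k") (auto simp: power_divide)
  have a: "?\<gamma> * (y - real n * \<mu>) = - (y - real n * \<mu>) / \<sigma>" for y
    using \<sigma> by (simp add: field_simps)
  have e: "- ?\<gamma> * y = y / \<sigma>" for y by simp
  have "exp (- ?\<gamma> * (real n * \<mu>)) / ?\<gamma> ^ Suc k *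
      (inc_Gamma (Suc k) (?\<gamma> * (p - real n * \<mu>)) - inc_Gamma (Suc k) (?\<gamma> * (q - real n * \<mu>))) =
      G \<mu> \<sigma> n k p q"
    unfolding c a G_def eval_between_def by (simp add: algebra_simps)
  moreover have "?\<gamma> \<noteq> 0" using \<sigma> by simp
  ultimately show ?thesis
    using has_integral_Ioo_power_exp[of ?\<gamma> p q "real n * \<mu>" k] assms unfolding e by metis
qed

lemma has_integral_H:
  assumes "p \<le> q"
  shows "has_bochner_integral lborel
     (\<lambda>y. indicator {p<..<q} y * ((y - real n * \<mu>) ^ k * exp (- y / \<sigma>))) (H \<mu> \<sigma> n k p q)"
proof -
  let ?\<gamma> = "1 / \<sigma>"
  have c: "exp (- ?\<gamma> * (real n * \<mu>)) / ?\<gamma> ^ Suc k = exp (- real n * \<mu> / \<sigma>) * \<sigma> ^ (k + 1)"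
    using \<sigma> by (cases "even k") (auto simp: power_divide)
  have a: "?\<gamma> * (y - real n * \<mu>) = (y - real n * \<mu>) / \<sigma>" for y
    using \<sigma> by (simp add: field_simps)
  have e: "- ?\<gamma> * y = - y / \<sigma>" for y by simp
  have "exp (- ?\<gamma> * (real n * \<mu>)) / ?\<gamma> ^ Suc k *
      (inc_Gamma (Suc k) (?\<gamma> * (p - real n * \<mu>)) - inc_Gamma (Suc k) (?\<gamma> * (q - real n * \<mu>))) =
      H \<mu> \<sigma> n k p q"
    unfolding c a H_def eval_between_def by (simp add: algebra_simps)
  moreover have "?\<gamma> \<noteq> 0" using \<sigma> by simp
  ultimately show ?thesis
    using has_integral_Ioo_power_exp[of ?\<gamma> p q "real n * \<mu>" k] assms unfolding e by metis
qed

lemma has_integral_R: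
  assumes "p \<le> q"
  shows "has_bochner_integral lborel
     (\<lambda>y. indicator {p<..<q} y * ((y - real n * \<mu>) ^ k * exp (2 * y / \<sigma>))) (R \<mu> \<sigma> n k p q)"
proof -
  let ?\<gamma> = "- 2 / \<sigma>"
  have c: "exp (- ?\<gamma> * (real n * \<mu>)) / ?\<gamma> ^ Suc k = - (exp (2 * real n * \<mu> / \<sigma>) * \<sigma> ^ (k + 1) * (- 1) ^ k / 2 ^ (k + 1))"
    using \<sigma> by (cases "even k") (auto simp: power_divide)
  have a: "?\<gamma> * (y - real n * \<mu>) = - 2 * (y - real n * \<mu>) / \<sigma>" for y
    using \<sigma> by (simp add: field_simps)
  have e: "- ?\<gamma> * y = 2 * y / \<sigma>" for y by simp
  have "exp (- ?\<gamma> * (real n * \<mu>)) / ?\<gamma> ^ Suc k *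
      (inc_Gamma (Suc k) (?\<gamma> * (p - real n * \<mu>)) - inc_Gamma (Suc k) (?\<gamma> * (q - real n * \<mu>))) =
      R \<mu> \<sigma> n k p q"
    unfolding c a R_def eval_between_def by (simp add: algebra_simps)
  moreover have "?\<gamma> \<noteq> 0" using \<sigma> by simp
  ultimately show ?thesis
    using has_integral_Ioo_power_exp[of ?\<gamma> p q "real n * \<mu>" k] assms unfolding e by metis
qed

lemma has_integral_S:
  assumes "p \<le> q"
  shows "has_bochner_integral lborel
     (\<lambda>y. indicator {p<..<q} y * ((y - real n * \<mu>) ^ k * exp (- 2 * y / \<sigma>))) (S \<mu> \<sigma> n k p q)"
proof -
  let ?\<gamma> = "2 / \<sigma>"
  have c: "exp (- ?\<gamma> * (real n * \<mu>)) / ?\<gamma> ^ Suc k = exp (- 2 * real n * \<mu> / \<sigma>) * \<sigma> ^ (k + 1) / 2 ^ (k + 1)"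
    using \<sigma> by (cases "even k") (auto simp: power_divide)
  have a: "?\<gamma> * (y - real n * \<mu>) = 2 * (y - real n * \<mu>) / \<sigma>" for y
    using \<sigma> by (simp add: field_simps)
  have e: "- ?\<gamma> * y = - 2 * y / \<sigma>" for y by simp
  have "exp (- ?\<gamma> * (real n * \<mu>)) / ?\<gamma> ^ Suc k *
      (inc_Gamma (Suc k) (?\<gamma> * (p - real n * \<mu>)) - inc_Gamma (Suc k) (?\<gamma> * (q - real n * \<mu>))) =
      S \<mu> \<sigma> n k p q"
    unfolding c a S_def eval_between_def by (simp add: algebra_simps)
  moreover have "?\<gamma> \<noteq> 0" using \<sigma> by simp
  ultimately show ?thesis
    using has_integral_Ioo_power_exp[of ?\<gamma> p q "real n * \<mu>" k] assms unfolding e by metis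
qed

lemma has_integral_weighted_tail:
  "has_bochner_integral lborel
     (\<lambda>y. indicator {p<..} y * ((y - real n * \<mu>) ^ k * exp (- 2 * y / \<sigma>))) (weighted_tail \<mu> \<sigma> n k p)"
  using has_integral_Ioi_power_exp[of "2 / \<sigma>" p "real n * \<mu>" k] \<sigma>
  by (simp add: weighted_tail_def power_divide field_simps)

end


section \<open>Integrals against two-sided exponential kernels\<close>

text \<open>
  For the weight \<open>1\<close>, which is the case of the increments \<open>Q\<close>, the factor \<open>1\<close> is kept visible so that
  \<open>has_integral_polynomial\<close> applies.
\<close>

lemma has_integral_times_one:
  "has_bochner_integral M (\<lambda>y. f y * g y) r \<Longrightarrow> has_bochner_integral M (\<lambda>y. f y * (g y * (1::real))) r"
  by simp

lemma has_integral_polynomial: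
  assumes "\<And>k. has_bochner_integral lborel (\<lambda>y. indicator J y * ((y - d) ^ k * e y)) (V k)"
  shows "has_bochner_integral lborel
      (\<lambda>y. indicator J y * ((\<Sum>k = 0..<n. \<alpha> k * (y - d) ^ k) * e y)) (\<Sum>k = 0..<n. \<alpha> k * V k :: real)"
proof -
  have "has_bochner_integral lborel (\<lambda>y. \<Sum>k = 0..<n. \<alpha> k * (indicator J y * ((y - d) ^ k * e y)))
      (\<Sum>k = 0..<n. \<alpha> k * V k)"
    by (intro has_bochner_integral_sum has_bochner_integral_mult_right assms)
  also have "(\<lambda>y. \<Sum>k = 0..<n. \<alpha> k * (indicator J y * ((y - d) ^ k * e y))) =
      (\<lambda>y. indicator J y * ((\<Sum>k = 0..<n. \<alpha> k * (y - d) ^ k) * e y))"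
    by (simp add: sum_distrib_left sum_distrib_right mult_ac)
  finally show ?thesis .
qed

text \<open>
  The common shape of \<open>y \<mapsto> f(u - y)\<close> and \<open>y \<mapsto> F(-y)\<close> for the Laplace density \<open>f\<close> and its distribution
  function \<open>F\<close>.
\<close>

definition exp_kernel :: "real \<Rightarrow> real \<Rightarrow> real \<Rightarrow> real \<Rightarrow> real \<Rightarrow> real \<Rightarrow> real" where
  "exp_kernel \<sigma> v \<kappa>0 \<kappa>1 \<kappa>2 y = (if y < v then \<kappa>0 + \<kappa>1 * exp (y / \<sigma>) else \<kappa>2 * exp (- y / \<sigma>))"

lemma borel_measurable_exp_kernel [measurable]: "exp_kernel \<sigma> v \<kappa>0 \<kappa>1 \<kappa>2 \<in> borel_measurable borel"
  unfolding exp_kernel_def[abs_def] by simp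

text \<open>
  The absolutely continuous part of the law of \<open>W\<^sub>n\<close>, with its change of formula at \<open>m\<close>. Beyond \<open>m\<close>
  only decaying exponentials occur.
\<close>

definition exp_poly_density ::
    "real \<Rightarrow> real \<Rightarrow> nat \<Rightarrow> (nat \<Rightarrow> real) \<Rightarrow> (nat \<Rightarrow> real) \<Rightarrow> (nat \<Rightarrow> real) \<Rightarrow> real \<Rightarrow> real \<Rightarrow> real" where
  "exp_poly_density \<mu> \<sigma> n \<alpha> \<beta> \<gamma> m y = 1 / (2 * \<sigma>) ^ n *
     (indicator {0<..<m} y * ((\<Sum>k = 0..<n. \<alpha> k * (y - real n * \<mu>) ^ k) * exp (y / \<sigma>)
         + (\<Sum>k = 0..<n. \<beta> k * (y - real n * \<mu>) ^ k) * exp (- y / \<sigma>))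
      + indicator {m<..} y * ((\<Sum>k = 0..<n. \<gamma> k * (y - real n * \<mu>) ^ k) * exp (- y / \<sigma>)))"

lemma borel_measurable_exp_poly_density [measurable]:
  "exp_poly_density \<mu> \<sigma> n \<alpha> \<beta> \<gamma> m \<in> borel_measurable borel"
  unfolding exp_poly_density_def[abs_def] by simp

context
  fixes \<mu> \<sigma> :: real
  assumes \<sigma>: "\<sigma> > 0"
begin

lemma exp_square_mult: "exp (y / \<sigma>) * (exp (y / \<sigma>) * z) = exp (2 * y / \<sigma>) * z"
  "exp (- (y / \<sigma>)) * (exp (- (y / \<sigma>)) * z) = exp (- 2 * y / \<sigma>) * z"
  "exp (y / \<sigma>) * (exp (- (y / \<sigma>)) * z) = z"
  by (simp_all add: mult.assoc[symmetric] exp_add[symmetric])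

lemma integrable_exp_poly_density:
  assumes "0 \<le> m"
  shows "integrable lborel (exp_poly_density \<mu> \<sigma> n \<alpha> \<beta> \<gamma> m)"
proof -
  note G = has_integral_polynomial[OF has_integral_G[OF \<sigma> assms], where n = n and \<alpha> = \<alpha>]
  note H = has_integral_polynomial[OF has_integral_H[OF \<sigma> assms], where n = n and \<alpha> = \<beta>]
  have "has_bochner_integral lborel
     (\<lambda>y. indicator {m<..} y * ((y - real n * \<mu>) ^ k * exp (- y / \<sigma>)))
     (exp (- (1 / \<sigma>) * (real n * \<mu>)) / (1 / \<sigma>) ^ Suc k * inc_Gamma (Suc k) (1 / \<sigma> * (m - real n * \<mu>)))" for k
    using has_integral_Ioi_power_exp[of "1 / \<sigma>" m "real n * \<mu>" k] \<sigma> by simp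
  note T = has_integral_polynomial[OF this, where n = n and \<alpha> = \<gamma>]
  show ?thesis
    unfolding exp_poly_density_def[abs_def] distrib_left[of "indicator _ _"]
    by (intro integrable_mult_right Bochner_Integration.integrable_add
        integrable.intros[OF G] integrable.intros[OF H] integrable.intros[OF T])
qed

text \<open>
  The lines are the contributions of \<open>(0, v)\<close> (from the two parts of the kernel there), of \<open>(v, m)\<close>
  and of \<open>(m, \<infinity>)\<close>. Products such as \<open>exp (y / \<sigma>) * exp (- y / \<sigma>) = 1\<close> turn the exponents into those of
  \<open>G\<close>, \<open>H\<close>, \<open>R\<close>, \<open>S\<close> and \<open>Q\<close>.
\<close>

lemma integral_exp_kernel_below:
  assumes "0 \<le> v" "v \<le> m"
  shows "(\<integral>y. exp_poly_density \<mu> \<sigma> n \<alpha> \<beta> \<gamma> m y * exp_kernel \<sigma> v \<kappa>0 \<kappa>1 \<kappa>2 y \<partial>lborel) =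
    1 / (2 * \<sigma>) ^ n *
      (\<kappa>0 * (\<Sum>k = 0..<n. \<alpha> k * G \<mu> \<sigma> n k 0 v + \<beta> k * H \<mu> \<sigma> n k 0 v)
       + \<kappa>1 * (\<Sum>k = 0..<n. \<alpha> k * R \<mu> \<sigma> n k 0 v + \<beta> k * Q \<mu> n k 0 v)
       + \<kappa>2 * (\<Sum>k = 0..<n. \<alpha> k * Q \<mu> n k v m + \<beta> k * S \<mu> \<sigma> n k v m)
       + \<kappa>2 * (\<Sum>k = 0..<n. \<gamma> k * weighted_tail \<mu> \<sigma> n k m))"
proof -
  let ?A = "\<lambda>y. \<Sum>k = 0..<n. \<alpha> k * (y - real n * \<mu>) ^ k"
  let ?B = "\<lambda>y. \<Sum>k = 0..<n. \<beta> k * (y - real n * \<mu>) ^ k"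
  let ?C = "\<lambda>y. \<Sum>k = 0..<n. \<gamma> k * (y - real n * \<mu>) ^ k"
  let ?l = "\<lambda>y. indicator {0<..<v} y :: real" and ?r = "\<lambda>y. indicator {v<..<m} y :: real"
    and ?t = "\<lambda>y. indicator {m<..} y :: real"
  let ?g = "\<lambda>y. 1 / (2 * \<sigma>) ^ n *
      (\<kappa>0 * (?l y * (?A y * exp (y / \<sigma>)) + ?l y * (?B y * exp (- y / \<sigma>)))
       + \<kappa>1 * (?l y * (?A y * exp (2 * y / \<sigma>)) + ?l y * (?B y * 1))
       + \<kappa>2 * (?r y * (?A y * 1) + ?r y * (?B y * exp (- 2 * y / \<sigma>)))
       + \<kappa>2 * (?t y * (?C y * exp (- 2 * y / \<sigma>))))"
  note Q' = has_integral_Q[THEN has_integral_times_one]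
  have "has_bochner_integral lborel ?g (1 / (2 * \<sigma>) ^ n *
      (\<kappa>0 * ((\<Sum>k = 0..<n. \<alpha> k * G \<mu> \<sigma> n k 0 v) + (\<Sum>k = 0..<n. \<beta> k * H \<mu> \<sigma> n k 0 v))
       + \<kappa>1 * ((\<Sum>k = 0..<n. \<alpha> k * R \<mu> \<sigma> n k 0 v) + (\<Sum>k = 0..<n. \<beta> k * Q \<mu> n k 0 v))
       + \<kappa>2 * ((\<Sum>k = 0..<n. \<alpha> k * Q \<mu> n k v m) + (\<Sum>k = 0..<n. \<beta> k * S \<mu> \<sigma> n k v m))
       + \<kappa>2 * (\<Sum>k = 0..<n. \<gamma> k * weighted_tail \<mu> \<sigma> n k m)))"
    by (intro has_bochner_integral_mult_right has_bochner_integral_add has_integral_polynomial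
        has_integral_G[OF \<sigma>] has_integral_H[OF \<sigma>] has_integral_R[OF \<sigma>] has_integral_S[OF \<sigma>]
        has_integral_weighted_tail[OF \<sigma>] Q' assms)
  moreover have "(\<integral>y. exp_poly_density \<mu> \<sigma> n \<alpha> \<beta> \<gamma> m y * exp_kernel \<sigma> v \<kappa>0 \<kappa>1 \<kappa>2 y \<partial>lborel) = (\<integral>y. ?g y \<partial>lborel)"
  proof (rule integral_cong_AE)
    show "AE y in lborel. exp_poly_density \<mu> \<sigma> n \<alpha> \<beta> \<gamma> m y * exp_kernel \<sigma> v \<kappa>0 \<kappa>1 \<kappa>2 y = ?g y"
      using AE_lborel_singleton[of v]
    proof eventually_elim
      case (elim y)
      consider "y < v" "0 < y" | "v < y" "y < m" | "m < y" "v < y" | "y \<le> 0" | "y = m" "v < y"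
        using elim assms by linarith
      then show ?case
        using assms
        by cases (simp_all add: exp_poly_density_def exp_kernel_def indicator_def algebra_simps exp_square_mult add_divide_distrib)
    qed
  qed simp_all
  ultimately show ?thesis by (simp only: has_bochner_integral_iff sum.distrib)
qed

text \<open>
  Here the threshold lies in the unbounded piece, and the contributions are those of \<open>(0, m)\<close>,
  \<open>(m, v)\<close> and \<open>(v, \<infinity>)\<close>.
\<close>

lemma integral_exp_kernel_above:
  assumes "0 \<le> m" "m \<le> v"
  shows "(\<integral>y. exp_poly_density \<mu> \<sigma> n \<alpha> \<beta> \<gamma> m y * exp_kernel \<sigma> v \<kappa>0 \<kappa>1 \<kappa>2 y \<partial>lborel) =
    1 / (2 * \<sigma>) ^ n *
      (\<kappa>0 * (\<Sum>k = 0..<n. \<alpha> k * G \<mu> \<sigma> n k 0 m + \<beta> k * H \<mu> \<sigma> n k 0 m)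
       + \<kappa>1 * (\<Sum>k = 0..<n. \<alpha> k * R \<mu> \<sigma> n k 0 m + \<beta> k * Q \<mu> n k 0 m)
       + \<kappa>0 * (\<Sum>k = 0..<n. \<gamma> k * H \<mu> \<sigma> n k m v)
       + \<kappa>1 * (\<Sum>k = 0..<n. \<gamma> k * Q \<mu> n k m v)
       + \<kappa>2 * (\<Sum>k = 0..<n. \<gamma> k * weighted_tail \<mu> \<sigma> n k v))"
proof -
  let ?A = "\<lambda>y. \<Sum>k = 0..<n. \<alpha> k * (y - real n * \<mu>) ^ k"
  let ?B = "\<lambda>y. \<Sum>k = 0..<n. \<beta> k * (y - real n * \<mu>) ^ k"
  let ?C = "\<lambda>y. \<Sum>k = 0..<n. \<gamma> k * (y - real n * \<mu>) ^ k"
  let ?l = "\<lambda>y. indicator {0<..<m} y :: real" and ?r = "\<lambda>y. indicator {m<..<v} y :: real"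
    and ?t = "\<lambda>y. indicator {v<..} y :: real"
  let ?g = "\<lambda>y. 1 / (2 * \<sigma>) ^ n *
      (\<kappa>0 * (?l y * (?A y * exp (y / \<sigma>)) + ?l y * (?B y * exp (- y / \<sigma>)))
       + \<kappa>1 * (?l y * (?A y * exp (2 * y / \<sigma>)) + ?l y * (?B y * 1))
       + \<kappa>0 * (?r y * (?C y * exp (- y / \<sigma>)))
       + \<kappa>1 * (?r y * (?C y * 1))
       + \<kappa>2 * (?t y * (?C y * exp (- 2 * y / \<sigma>))))"
  note Q' = has_integral_Q[THEN has_integral_times_one]
  have "has_bochner_integral lborel ?g (1 / (2 * \<sigma>) ^ n *
      (\<kappa>0 * ((\<Sum>k = 0..<n. \<alpha> k * G \<mu> \<sigma> n k 0 m) + (\<Sum>k = 0..<n. \<beta> k * H \<mu> \<sigma> n k 0 m))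
       + \<kappa>1 * ((\<Sum>k = 0..<n. \<alpha> k * R \<mu> \<sigma> n k 0 m) + (\<Sum>k = 0..<n. \<beta> k * Q \<mu> n k 0 m))
       + \<kappa>0 * (\<Sum>k = 0..<n. \<gamma> k * H \<mu> \<sigma> n k m v)
       + \<kappa>1 * (\<Sum>k = 0..<n. \<gamma> k * Q \<mu> n k m v)
       + \<kappa>2 * (\<Sum>k = 0..<n. \<gamma> k * weighted_tail \<mu> \<sigma> n k v)))"
    by (intro has_bochner_integral_mult_right has_bochner_integral_add has_integral_polynomial
        has_integral_G[OF \<sigma>] has_integral_H[OF \<sigma>] has_integral_R[OF \<sigma>]
        has_integral_weighted_tail[OF \<sigma>] Q' assms)
  moreover have "(\<integral>y. exp_poly_density \<mu> \<sigma> n \<alpha> \<beta> \<gamma> m y * exp_kernel \<sigma> v \<kappa>0 \<kappa>1 \<kappa>2 y \<partial>lborel) = (\<integral>y. ?g y \<partial>lborel)"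
  proof (rule integral_cong_AE)
    show "AE y in lborel. exp_poly_density \<mu> \<sigma> n \<alpha> \<beta> \<gamma> m y * exp_kernel \<sigma> v \<kappa>0 \<kappa>1 \<kappa>2 y = ?g y"
      using AE_lborel_singleton[of v]
    proof eventually_elim
      case (elim y)
      consider "y < m" "0 < y" | "m < y" "y < v" | "v < y" | "y \<le> 0" | "y = m" "y < v"
        using elim assms by linarith
      then show ?case
        using assms
        by cases (simp_all add: exp_poly_density_def exp_kernel_def indicator_def algebra_simps exp_square_mult add_divide_distrib)
    qed
  qed simp_all
  ultimately show ?thesis by (simp only: has_bochner_integral_iff sum.distrib)
qed

lemma laplace_density_eq_exp_kernel:
  "laplace_density \<mu> \<sigma> (u - y) =
     exp_kernel \<sigma> (u - \<mu>) 0 (exp (- (u - \<mu>) / \<sigma>) / (2 * \<sigma>)) (exp ((u - \<mu>) / \<sigma>) / (2 * \<sigma>)) y"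
proof -
  have "exp (- (u - \<mu>) / \<sigma>) * exp (y / \<sigma>) = exp (- (u - y - \<mu>) / \<sigma>)"
    "exp ((u - \<mu>) / \<sigma>) * exp (- y / \<sigma>) = exp ((u - y - \<mu>) / \<sigma>)"
    by (simp_all add: exp_add[symmetric] diff_divide_distrib add_divide_distrib)
  moreover have "- \<bar>u - y - \<mu>\<bar> = (if y < u - \<mu> then - (u - y - \<mu>) else u - y - \<mu>)" by auto
  ultimately show ?thesis by (simp add: laplace_density_def exp_kernel_def)
qed

text \<open>
  Reflecting \<open>z\<close> turns this into the tail beyond \<open>w\<close> of a Laplace density with location \<open>- \<mu>\<close>, which
  is where the threshold \<open>- \<mu>\<close> comes from.
\<close>

lemma laplace_cdf_eq_exp_kernel:
  "(\<integral>z. laplace_density \<mu> \<sigma> z * indicator {..- w} z \<partial>lborel) =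
     exp_kernel \<sigma> (- \<mu>) 1 (- (exp (\<mu> / \<sigma>) / 2)) (exp (- \<mu> / \<sigma>) / 2) w"
proof -
  have tail: "has_bochner_integral lborel
      (\<lambda>y. exp (- \<mu> / \<sigma>) / (2 * \<sigma>) * (indicator {p<..} y * exp (- y / \<sigma>)))
      (exp (- \<mu> / \<sigma>) / 2 * exp (- p / \<sigma>))" for p
  proof -
    have "has_bochner_integral lborel (\<lambda>y. indicator {p<..} y * exp (- y / \<sigma>)) (\<sigma> * exp (- p / \<sigma>))"
      using has_integral_Ioi_power_exp[of "1 / \<sigma>" p 0 0] inc_Gamma_eq_exp_poly[of 0] \<sigma>
      by (simp add: exp_poly_def)
    from has_bochner_integral_mult_right[OF this, of "exp (- \<mu> / \<sigma>) / (2 * \<sigma>)"] show ?thesis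
      using \<sigma> by simp
  qed
  have left: "has_bochner_integral lborel
      (\<lambda>y. exp (\<mu> / \<sigma>) / (2 * \<sigma>) * (indicator {w<..<- \<mu>} y * exp (y / \<sigma>)))
      (exp (\<mu> / \<sigma>) / 2 * (exp (- \<mu> / \<sigma>) - exp (w / \<sigma>)))" if "w \<le> - \<mu>"
  proof -
    have "has_bochner_integral lborel (\<lambda>y. indicator {w<..<- \<mu>} y * exp (y / \<sigma>)) (\<sigma> * exp (- \<mu> / \<sigma>) - \<sigma> * exp (w / \<sigma>))"
    proof -
      have "((\<lambda>y. \<sigma> * exp (y / \<sigma>)) has_real_derivative exp (y / \<sigma>)) (at y)" for y
        using \<sigma> by (auto intro!: derivative_eq_intros)
      from has_integral_Ioo_FTC[OF that this] show ?thesis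
        using \<sigma> unfolding eval_between_def by simp
    qed
    from has_bochner_integral_mult_right[OF this, of "exp (\<mu> / \<sigma>) / (2 * \<sigma>)"] show ?thesis
      using \<sigma> by (simp add: right_diff_distrib)
  qed
  have refl: "(\<integral>z. laplace_density \<mu> \<sigma> z * indicator {..- w} z \<partial>lborel) =
      (\<integral>y. laplace_density \<mu> \<sigma> (- y) * indicator {w..} y \<partial>lborel)"
    by (subst lborel_integral_real_affine[of "- 1" _ 0]) (auto simp: indicator_def intro!: Bochner_Integration.integral_cong)
  have lap: "laplace_density \<mu> \<sigma> (- y) = (if y < - \<mu> then exp (\<mu> / \<sigma>) / (2 * \<sigma>) * exp (y / \<sigma>)
      else exp (- \<mu> / \<sigma>) / (2 * \<sigma>) * exp (- y / \<sigma>))" for y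
    using laplace_density_eq_exp_kernel[of 0 y] by (auto simp: exp_kernel_def)
  have [measurable]: "(\<lambda>y. laplace_density \<mu> \<sigma> (- y)) \<in> borel_measurable borel"
    unfolding laplace_density_def by simp
  show ?thesis
  proof (cases "w < - \<mu>")
    case True
    have "(\<integral>y. laplace_density \<mu> \<sigma> (- y) * indicator {w..} y \<partial>lborel) =
        (\<integral>y. exp (\<mu> / \<sigma>) / (2 * \<sigma>) * (indicator {w<..<- \<mu>} y * exp (y / \<sigma>))
          + exp (- \<mu> / \<sigma>) / (2 * \<sigma>) * (indicator {- \<mu><..} y * exp (- y / \<sigma>)) \<partial>lborel)"
    proof (rule integral_cong_AE)
      show "AE y in lborel. laplace_density \<mu> \<sigma> (- y) * indicator {w..} y =
          exp (\<mu> / \<sigma>) / (2 * \<sigma>) * (indicator {w<..<- \<mu>} y * exp (y / \<sigma>))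
          + exp (- \<mu> / \<sigma>) / (2 * \<sigma>) * (indicator {- \<mu><..} y * exp (- y / \<sigma>))"
        using AE_lborel_singleton[of w] AE_lborel_singleton[of "- \<mu>"]
        by eventually_elim (use True in \<open>auto simp: lap indicator_def\<close>)
    qed simp_all
    also have "\<dots> = exp (\<mu> / \<sigma>) / 2 * (exp (- \<mu> / \<sigma>) - exp (w / \<sigma>)) + exp (- \<mu> / \<sigma>) / 2 * exp (- (- \<mu>) / \<sigma>)"
      using has_bochner_integral_add[OF left tail[of "- \<mu>"]] True by (simp add: has_bochner_integral_iff)
    also have "\<dots> = 1 - exp (\<mu> / \<sigma>) / 2 * exp (w / \<sigma>)"
      using exp_square_mult(3)[of \<mu> 1] by (simp add: field_simps)
    finally show ?thesis using True refl by (simp add: exp_kernel_def)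
  next
    case False
    have "(\<integral>y. laplace_density \<mu> \<sigma> (- y) * indicator {w..} y \<partial>lborel) =
        (\<integral>y. exp (- \<mu> / \<sigma>) / (2 * \<sigma>) * (indicator {w<..} y * exp (- y / \<sigma>)) \<partial>lborel)"
    proof (rule integral_cong_AE)
      show "AE y in lborel. laplace_density \<mu> \<sigma> (- y) * indicator {w..} y =
          exp (- \<mu> / \<sigma>) / (2 * \<sigma>) * (indicator {w<..} y * exp (- y / \<sigma>))"
        using AE_lborel_singleton[of w]
        by eventually_elim (use False in \<open>auto simp: lap indicator_def\<close>)
    qed simp_all
    also have "\<dots> = exp (- \<mu> / \<sigma>) / 2 * exp (- w / \<sigma>)"
      using tail[of w] by (simp add: has_bochner_integral_iff)
    finally show ?thesis using False refl by (simp add: exp_kernel_def)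
  qed
qed

end


section \<open>Closed forms and the interchange of summation\<close>

text \<open>
  \<open>poly_up\<close> is the polynomial factor of the antiderivative of \<open>s ^ k * exp (2 s / \<sigma>)\<close>, and
  \<open>poly_down\<close> that of the negative antiderivative of \<open>s ^ k * exp (- 2 s / \<sigma>)\<close>.
\<close>

definition poly_up :: "real \<Rightarrow> nat \<Rightarrow> real \<Rightarrow> real" where
  "poly_up \<sigma> k s = (\<Sum>j\<le>k. (- 1) ^ (k + j) * (fact k / fact j) * (\<sigma> / 2) ^ (k + 1 - j) * s ^ j)"

definition poly_down :: "real \<Rightarrow> nat \<Rightarrow> real \<Rightarrow> real" where
  "poly_down \<sigma> k s = (\<Sum>j\<le>k. fact k / fact j * (\<sigma> / 2) ^ (k + 1 - j) * s ^ j)"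

lemma sum_atMost_eq_shifted:
  fixes f :: "nat \<Rightarrow> real"
  shows "(\<Sum>j\<le>k. f j) = f 0 + (\<Sum>j = 1..k + 1. f j) - f (k + 1)"
proof -
  have "(\<Sum>j = 0..k + 1. f j) = f 0 + (\<Sum>j = 1..k + 1. f j)"
    by (subst sum.atLeast_Suc_atMost) auto
  then show ?thesis by (simp add: atMost_atLeast0)
qed

text \<open>
  The sums over \<open>j\<close> that come out of the recursion run from \<open>1\<close> to \<open>k + 1\<close>. Their term \<open>j = k + 1\<close>
  comes from integrating \<open>s ^ k\<close> alone, and the missing term \<open>j = 0\<close> is part of the separate
  formula for the constant coefficient.
\<close>

lemma poly_up_shifted:
  "(\<Sum>j = 1..k + 1. ((- 1) ^ (k + j) * (fact k / fact j) * (\<sigma> / 2) ^ (k + 1 - j)) * s ^ j) =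
     poly_up \<sigma> k s - (- 1) ^ k * fact k * (\<sigma> / 2) ^ (k + 1) - s ^ (k + 1) / real (k + 1)"
proof -
  have "fact k / fact (k + 1) = 1 / real (k + 1)" by (simp add: divide_simps)
  moreover have "(- 1 :: real) ^ (k + (k + 1)) = - 1" by simp
  ultimately show ?thesis
    unfolding poly_up_def sum_atMost_eq_shifted by (simp del: fact_Suc sum.cl_ivl_Suc)
qed

lemma poly_down_shifted:
  "(\<Sum>j = 1..k + 1. (fact k / fact j * (\<sigma> / 2) ^ (k + 1 - j)) * s ^ j) =
     poly_down \<sigma> k s - fact k * (\<sigma> / 2) ^ (k + 1) + s ^ (k + 1) / real (k + 1)"
proof -
  have "fact k / fact (k + 1) = 1 / real (k + 1)" by (simp add: divide_simps)
  then show ?thesis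
    unfolding poly_down_def sum_atMost_eq_shifted by (simp del: fact_Suc sum.cl_ivl_Suc)
qed

lemma half_power_exp_poly:
  assumes "\<sigma> > 0"
  shows "\<sigma> ^ (k + 1) / 2 ^ (k + 1) * exp_poly k (2 * s / \<sigma>) = poly_down \<sigma> k s"
    and "\<sigma> ^ (k + 1) * (- 1) ^ k / 2 ^ (k + 1) * exp_poly k (- 2 * s / \<sigma>) = poly_up \<sigma> k s"
proof -
  have pw: "\<sigma> ^ (k + 1) / 2 ^ (k + 1) * (2 / \<sigma>) ^ j = (\<sigma> / 2) ^ (k + 1 - j)" if "j \<le> k" for j
  proof -
    have "\<sigma> ^ (k + 1) / 2 ^ (k + 1) = (\<sigma> / 2) ^ (k + 1 - j) * (\<sigma> / 2) ^ j"
      using that by (simp add: power_divide power_add[symmetric])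
    moreover have "(\<sigma> / 2) ^ j * (2 / \<sigma>) ^ j = 1"
      using assms by (simp add: power_mult_distrib[symmetric])
    ultimately show ?thesis by (simp add: mult.assoc)
  qed
  have 1: "(2 * s / \<sigma>) ^ j = (2 / \<sigma>) ^ j * s ^ j" for j
    by (simp add: power_mult_distrib[symmetric])
  have 2: "(- 2 * s / \<sigma>) ^ j = (- 1) ^ j * ((2 / \<sigma>) ^ j * s ^ j)" for j
    by (simp add: power_mult_distrib[symmetric])
  have "\<sigma> ^ (k + 1) / 2 ^ (k + 1) * (fact k / fact j * (2 * s / \<sigma>) ^ j) =
      fact k / fact j * (\<sigma> / 2) ^ (k + 1 - j) * s ^ j" if "j \<le> k" for j
    unfolding 1 pw[OF that, symmetric] by (simp only: mult_ac)
  then show "\<sigma> ^ (k + 1) / 2 ^ (k + 1) * exp_poly k (2 * s / \<sigma>) = poly_down \<sigma> k s"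
    unfolding exp_poly_def poly_down_def sum_distrib_left by (intro sum.cong) auto
  have "\<sigma> ^ (k + 1) * (- 1) ^ k / 2 ^ (k + 1) * (fact k / fact j * (- 2 * s / \<sigma>) ^ j) =
      (- 1) ^ (k + j) * (fact k / fact j) * (\<sigma> / 2) ^ (k + 1 - j) * s ^ j" if "j \<le> k" for j
  proof -
    have "\<sigma> ^ (k + 1) * (- 1) ^ k / 2 ^ (k + 1) * (fact k / fact j * (- 2 * s / \<sigma>) ^ j) =
        ((- 1) ^ k * (- 1) ^ j) * (fact k / fact j) * (\<sigma> ^ (k + 1) / 2 ^ (k + 1) * (2 / \<sigma>) ^ j) * s ^ j"
      unfolding 2 by (simp only: divide_inverse mult_ac)
    then show ?thesis by (simp only: pw[OF that] power_add[of "- 1"])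
  qed
  then show "\<sigma> ^ (k + 1) * (- 1) ^ k / 2 ^ (k + 1) * exp_poly k (- 2 * s / \<sigma>) = poly_up \<sigma> k s"
    unfolding exp_poly_def poly_up_def sum_distrib_left by (intro sum.cong) auto
qed

lemma weighted_tail_closed_form:
  assumes "\<sigma> > 0"
  shows "weighted_tail \<mu> \<sigma> n k v = exp (- 2 * v / \<sigma>) * poly_down \<sigma> k (v - real n * \<mu>)"
proof -
  have "exp (- 2 * real n * \<mu> / \<sigma>) * exp (- (2 * (v - real n * \<mu>) / \<sigma>)) = exp (- 2 * v / \<sigma>)"
    using assms by (simp add: exp_add[symmetric] field_simps)
  then show ?thesis
    unfolding weighted_tail_def half_power_exp_poly(1)[OF assms, symmetric]
    by (simp add: inc_Gamma_eq_exp_poly)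
qed

text \<open>
  The value at \<open>y = 0\<close> of the antiderivative that defines \<open>R\<close>.
\<close>

definition weighted_head :: "real \<Rightarrow> real \<Rightarrow> nat \<Rightarrow> nat \<Rightarrow> real" where
  "weighted_head \<mu> \<sigma> n k = exp (2 * real n * \<mu> / \<sigma>) * \<sigma> ^ (k + 1) * (- 1) ^ k / 2 ^ (k + 1) *
     inc_Gamma (1 + k) (2 * real n * \<mu> / \<sigma>)"

lemma R_closed_form:
  assumes "\<sigma> > 0"
  shows "R \<mu> \<sigma> n k 0 v = exp (2 * v / \<sigma>) * poly_up \<sigma> k (v - real n * \<mu>) - weighted_head \<mu> \<sigma> n k"
proof -
  have "exp (2 * real n * \<mu> / \<sigma>) * exp (- (- 2 * (v - real n * \<mu>) / \<sigma>)) = exp (2 * v / \<sigma>)"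
    using assms by (simp add: exp_add[symmetric] field_simps)
  moreover have "A * B * C / D * (E * P - I) = (A * E) * (B * C / D * P) - A * B * C / D * I" for A B C D E P I :: real
    by (simp add: right_diff_distrib)
  moreover have "- 2 * (0 - real n * \<mu>) / \<sigma> = 2 * real n * \<mu> / \<sigma>" by simp
  ultimately show ?thesis
    unfolding R_def eval_between_def weighted_head_def half_power_exp_poly(2)[OF assms, symmetric]
    by (simp only: inc_Gamma_eq_exp_poly[of k "- 2 * (v - real n * \<mu>) / \<sigma>"] plus_1_eq_Suc)
qed

lemma S_eq_weighted_tail: "S \<mu> \<sigma> n k p q = weighted_tail \<mu> \<sigma> n k p - weighted_tail \<mu> \<sigma> n k q"
  unfolding S_def weighted_tail_def eval_between_def by (simp add: algebra_simps)

text \<open>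
  The coefficient recursion says that the term with index \<open>k\<close> of the old density is
  replaced by a polynomial with coefficients \<open>w k 1, \<dots>, w k (k + 1)\<close>, apart from the constant terms,
  which are collected in \<open>K\<close>.
\<close>

lemma polynomial_of_recursion:
  fixes a' \<alpha> :: "nat \<Rightarrow> real"
  assumes "\<And>j. j \<in> {1..n} \<Longrightarrow> a' j = E * (\<Sum>k = j - 1..<n. \<alpha> k * w k j)" and "a' 0 = E * K"
  shows "(\<Sum>j = 0..<n + 1. a' j * s ^ j) = E * (K + (\<Sum>k = 0..<n. \<alpha> k * (\<Sum>j = 1..k + 1. w k j * s ^ j)))"
proof -
  have "(\<Sum>j = 0..<n + 1. a' j * s ^ j) = (\<Sum>j = 0..n. a' j * s ^ j)"
    by (simp add: atLeastLessThanSuc_atLeastAtMost)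
  also have "\<dots> = a' 0 + (\<Sum>j = 1..n. a' j * s ^ j)"
    by (subst sum.atLeast_Suc_atMost) auto
  also have "(\<Sum>j = 1..n. a' j * s ^ j) = E * (\<Sum>j = 1..n. \<Sum>k = j - 1..<n. \<alpha> k * w k j * s ^ j)"
    by (simp add: assms(1) sum_distrib_left sum_distrib_right mult.assoc del: One_nat_def)
  also have "(\<Sum>j = 1..n. \<Sum>k = j - 1..<n. \<alpha> k * w k j * s ^ j) =
      (\<Sum>j = 1..n. \<Sum>k\<in>{k\<in>{0..<n}. j \<le> k + 1}. \<alpha> k * w k j * s ^ j)"
    by (intro sum.cong) auto
  also have "\<dots> = (\<Sum>k = 0..<n. \<Sum>j\<in>{j\<in>{1..n}. j \<le> k + 1}. \<alpha> k * w k j * s ^ j)"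
    by (rule sum.swap_restrict) auto
  also have "\<dots> = (\<Sum>k = 0..<n. \<alpha> k * (\<Sum>j = 1..k + 1. w k j * s ^ j))"
    unfolding sum_distrib_left by (intro sum.cong) (auto simp: mult.assoc)
  finally show ?thesis using assms(2) by (simp add: distrib_left)
qed



section \<open>One step of the coefficient recursion\<close>

lemma eval_between_self [simp]: "eval_between \<phi> p p = 0"
  by (simp add: eval_between_def)

lemma density_piece_factor:
  "density_piece \<mu> \<sigma> a b n i J u = 1 / (2 * \<sigma>) ^ n * (indicator J u *
      ((\<Sum>k = 0..<n. a n i k * (u - real n * \<mu>) ^ k) * exp (u / \<sigma>)
       + (\<Sum>k = 0..<n. b n i k * (u - real n * \<mu>) ^ k) * exp (- u / \<sigma>)))"
  unfolding density_piece_def sum_distrib_left[symmetric] sum_distrib_right sum.distrib[symmetric]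
  by (simp add: mult_ac)

lemma density_piece_lower:
  "density_piece \<mu> \<sigma> a b n 1 (I1 \<mu> x n) =
     exp_poly_density \<mu> \<sigma> n (a n 1) (b n 1) (\<lambda>_. 0) (max 0 (real n * \<mu> + x))"
  unfolding fun_eq_iff density_piece_factor by (simp add: exp_poly_density_def I1_def)

lemma density_piece_upper:
  assumes "\<And>k. k < n \<Longrightarrow> a n 2 k = 0"
  shows "density_piece \<mu> \<sigma> a b n 2 (I2 \<mu> x n) =
     exp_poly_density \<mu> \<sigma> n (\<lambda>_. 0) (\<lambda>_. 0) (b n 2) (max 0 (real n * \<mu> + x))"
  using assms unfolding fun_eq_iff density_piece_factor by (simp add: exp_poly_density_def I2_def)

context
  fixes \<mu> \<sigma> x :: real and a b :: "nat \<Rightarrow> nat \<Rightarrow> nat \<Rightarrow> real" and c :: "nat \<Rightarrow> real"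
  assumes \<sigma>: "\<sigma> > 0"
begin

abbreviation "law_density n \<equiv> exp_poly_density \<mu> \<sigma> n (a n 1) (b n 1) (b n 2) (max 0 (real n * \<mu> + x))"

text \<open>
  For \<open>0 < v < x + n \<mu>\<close> with \<open>v = u - \<mu>\<close> the integral gives, after inserting the closed forms, multiples
  of \<open>exp (v / \<sigma>)\<close> and of \<open>exp (- v / \<sigma>)\<close>. The first come from the upper ends of the \<open>R\<close> and
  \<open>S\<close> integrals, from \<open>Q\<close> over \<open>(v, x + n \<mu>)\<close> and from the tail; they form the new coefficients \<open>a\<close>. The
  second come from the lower ends and from \<open>Q\<close> over \<open>(0, v)\<close>; they form the new \<open>b\<close>.
  The atom contributes \<open>c n * f(u)\<close>, which belongs to the second kind because \<open>v > 0\<close>.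
\<close>

lemma density_step_below:
  assumes rec: "recursion_A \<mu> \<sigma> x a b c n" and pos: "0 < x + real n * \<mu>"
    and v: "0 < u - \<mu>" "u - \<mu> < x + real n * \<mu>"
  shows "c n * laplace_density \<mu> \<sigma> u + (\<integral>y. law_density n y * laplace_density \<mu> \<sigma> (u - y) \<partial>lborel) =
    1 / (2 * \<sigma>) ^ (n + 1) *
      ((\<Sum>j = 0..<n + 1. a (n + 1) 1 j * (u - real (n + 1) * \<mu>) ^ j) * exp (u / \<sigma>)
       + (\<Sum>j = 0..<n + 1. b (n + 1) 1 j * (u - real (n + 1) * \<mu>) ^ j) * exp (- u / \<sigma>))"
proof -
  define v where "v = u - \<mu>"
  define s where "s = u - real (n + 1) * \<mu>"
  \<comment> \<open>With the exponentials as opaque quantities with product \<open>1\<close>, everything below is polynomial algebra.\<close>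
  define X where "X = exp (v / \<sigma>)"
  define Y where "Y = exp (- v / \<sigma>)"
  have XY: "X * Y = 1" "Y * X = 1" unfolding X_def Y_def by (simp_all add: exp_add[symmetric])
  have X2: "exp (2 * v / \<sigma>) = X * X" and Y2: "exp (- 2 * v / \<sigma>) = Y * Y"
    unfolding X_def Y_def by (simp_all add: exp_add[symmetric])
  have s: "v - real n * \<mu> = s" unfolding v_def s_def by (simp add: algebra_simps)
  have EX: "exp (- \<mu> / \<sigma>) * exp (u / \<sigma>) = X" and EY: "exp (\<mu> / \<sigma>) * exp (- u / \<sigma>) = Y"
    unfolding X_def Y_def v_def by (simp_all add: exp_add[symmetric] diff_divide_distrib add_divide_distrib)
  let ?a = "a n 1" and ?b = "b n 1" and ?g = "b n 2"
  let ?m = "x + real n * \<mu>"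
  let ?t = "\<lambda>k. weighted_tail \<mu> \<sigma> n k ?m" and ?r = "\<lambda>k. weighted_head \<mu> \<sigma> n k"
  let ?U = "\<lambda>k. poly_up \<sigma> k s - (- 1) ^ k * fact k * (\<sigma> / 2) ^ (k + 1) - s ^ (k + 1) / real (k + 1)"
  let ?D = "\<lambda>k. poly_down \<sigma> k s - fact k * (\<sigma> / 2) ^ (k + 1) + s ^ (k + 1) / real (k + 1)"
  have tail: "exp (- 2 * real n * \<mu> / \<sigma>) * \<sigma> ^ (k + 1) / 2 ^ (k + 1) * inc_Gamma (1 + k) (2 * x / \<sigma>) = ?t k" for k
    unfolding weighted_tail_def by simp
  have head: "exp (2 * real n * \<mu> / \<sigma>) * \<sigma> ^ (k + 1) * (- 1) ^ k / 2 ^ (k + 1) * inc_Gamma (1 + k) (2 * real n * \<mu> / \<sigma>) = ?r k" for k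
    unfolding weighted_head_def by simp
  define TA where "TA k = ?a k * (x ^ (k + 1) / real (k + 1) + (- 1) ^ k * fact k * (\<sigma> / 2) ^ (k + 1)) - ?b k * ?t k" for k
  define TB where "TB k = ?b k * (- ((- real n * \<mu>) ^ (k + 1) / real (k + 1)) + fact k * (\<sigma> / 2) ^ (k + 1)) - ?a k * ?r k" for k
  have A: "(\<Sum>j = 0..<n + 1. a (n + 1) 1 j * s ^ j) = exp (- \<mu> / \<sigma>) *
      (((\<Sum>k = 0..<n. ?g k * ?t k) + (\<Sum>k = 0..<n. TA k)) + (\<Sum>k = 0..<n. ?a k * ?U k))"
    unfolding poly_up_shifted[symmetric]
  proof (rule polynomial_of_recursion)
    show "a (n + 1) 1 0 = exp (- \<mu> / \<sigma>) * ((\<Sum>k = 0..<n. ?g k * ?t k) + (\<Sum>k = 0..<n. TA k))"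
      using rec unfolding recursion_A_def B2_def TA_def tail[symmetric] by (simp only: mult.assoc)
    show "a (n + 1) 1 j = exp (- \<mu> / \<sigma>) * (\<Sum>k = j - 1..<n. ?a k * ((- 1) ^ (k + j) * (fact k / fact j) * (\<sigma> / 2) ^ (k + 1 - j)))"
      if "j \<in> {1..n}" for j
      using rec that unfolding recursion_A_def by (simp add: mult_ac)
  qed
  have B: "(\<Sum>j = 0..<n + 1. b (n + 1) 1 j * s ^ j) = exp (\<mu> / \<sigma>) *
      (((\<Sum>k = 0..<n. TB k) + (2 * \<sigma>) ^ n * c n) + (\<Sum>k = 0..<n. ?b k * ?D k))"
    unfolding poly_down_shifted[symmetric]
  proof (rule polynomial_of_recursion)
    show "b (n + 1) 1 0 = exp (\<mu> / \<sigma>) * ((\<Sum>k = 0..<n. TB k) + (2 * \<sigma>) ^ n * c n)"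
      using rec unfolding recursion_A_def TB_def head[symmetric] by (simp only: mult.assoc)
    show "b (n + 1) 1 j = exp (\<mu> / \<sigma>) * (\<Sum>k = j - 1..<n. ?b k * (fact k / fact j * (\<sigma> / 2) ^ (k + 1 - j)))"
      if "j \<in> {1..n}" for j
      using rec that unfolding recursion_A_def by (simp add: mult_ac)
  qed
  \<comment> \<open>the contribution of the \<open>k\<close>-th coefficients, sorted by \<open>X\<close> and \<open>Y\<close>\<close>
  have term_eq: "Y * (?a k * R \<mu> \<sigma> n k 0 v + ?b k * Q \<mu> n k 0 v)
      + X * (?a k * Q \<mu> n k v ?m + ?b k * S \<mu> \<sigma> n k v ?m) =
      X * (TA k + ?a k * ?U k) + Y * (TB k + ?b k * ?D k)" for k
  proof -
    have Q: "Q \<mu> n k 0 v = s ^ (k + 1) / real (k + 1) - (- real n * \<mu>) ^ (k + 1) / real (k + 1)"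
      "Q \<mu> n k v ?m = x ^ (k + 1) / real (k + 1) - s ^ (k + 1) / real (k + 1)"
      unfolding Q_def eval_between_def s by simp_all
    have "Y * (X * X * z) = X * z" "X * (Y * Y * z) = Y * z" for z
      using XY by (metis mult.assoc mult.left_neutral)+
    then have RS: "Y * R \<mu> \<sigma> n k 0 v = X * poly_up \<sigma> k s - Y * ?r k"
      "X * S \<mu> \<sigma> n k v ?m = Y * poly_down \<sigma> k s - X * ?t k"
      unfolding R_closed_form[OF \<sigma>] S_eq_weighted_tail weighted_tail_closed_form[OF \<sigma>, of _ _ _ v] s X2 Y2
      by (simp_all only: right_diff_distrib)
    have "?a k * (Y * R \<mu> \<sigma> n k 0 v) + ?b k * (X * S \<mu> \<sigma> n k v ?m) + Y * (?b k * Q \<mu> n k 0 v) + X * (?a k * Q \<mu> n k v ?m) =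
      X * (TA k + ?a k * ?U k) + Y * (TB k + ?b k * ?D k)"
      unfolding RS Q TA_def TB_def by (simp add: algebra_simps del: power_Suc)
    then show ?thesis by (simp only: algebra_simps)
  qed
  have "Y * (\<Sum>k = 0..<n. ?a k * R \<mu> \<sigma> n k 0 v + ?b k * Q \<mu> n k 0 v)
      + X * (\<Sum>k = 0..<n. ?a k * Q \<mu> n k v ?m + ?b k * S \<mu> \<sigma> n k v ?m) =
      (\<Sum>k = 0..<n. X * (TA k + ?a k * ?U k) + Y * (TB k + ?b k * ?D k))"
    unfolding term_eq[symmetric] by (simp only: sum.distrib sum_distrib_left distrib_left)
  also have "\<dots> = X * ((\<Sum>k = 0..<n. TA k) + (\<Sum>k = 0..<n. ?a k * ?U k))
      + Y * ((\<Sum>k = 0..<n. TB k) + (\<Sum>k = 0..<n. ?b k * ?D k))"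
    by (simp only: sum.distrib sum_distrib_left[symmetric])
  finally have sums: "Y * (\<Sum>k = 0..<n. ?a k * R \<mu> \<sigma> n k 0 v + ?b k * Q \<mu> n k 0 v)
      + X * (\<Sum>k = 0..<n. ?a k * Q \<mu> n k v ?m + ?b k * S \<mu> \<sigma> n k v ?m) =
      X * ((\<Sum>k = 0..<n. TA k) + (\<Sum>k = 0..<n. ?a k * ?U k))
      + Y * ((\<Sum>k = 0..<n. TB k) + (\<Sum>k = 0..<n. ?b k * ?D k))" .
  have c0: "laplace_density \<mu> \<sigma> u = Y / (2 * \<sigma>)"
    using laplace_density_eq_exp_kernel[OF \<sigma>, of \<mu> u 0] v by (simp add: exp_kernel_def Y_def v_def)
  have m: "max 0 (real n * \<mu> + x) = ?m" using pos by (simp add: add.commute)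
  have I: "(\<integral>y. law_density n y * laplace_density \<mu> \<sigma> (u - y) \<partial>lborel) = 1 / (2 * \<sigma>) ^ n *
      (Y / (2 * \<sigma>) * (\<Sum>k = 0..<n. ?a k * R \<mu> \<sigma> n k 0 v + ?b k * Q \<mu> n k 0 v)
       + X / (2 * \<sigma>) * (\<Sum>k = 0..<n. ?a k * Q \<mu> n k v ?m + ?b k * S \<mu> \<sigma> n k v ?m)
       + X / (2 * \<sigma>) * (\<Sum>k = 0..<n. ?g k * ?t k))"
    unfolding laplace_density_eq_exp_kernel[OF \<sigma>] m v_def[symmetric] X_def[symmetric] Y_def[symmetric]
    by (subst integral_exp_kernel_below[OF \<sigma>]) (use v v_def in auto)
  have "c n * laplace_density \<mu> \<sigma> u + (\<integral>y. law_density n y * laplace_density \<mu> \<sigma> (u - y) \<partial>lborel) =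
     1 / (2 * \<sigma>) ^ (n + 1) * (Y * ((2 * \<sigma>) ^ n * c n) +
       (Y * (\<Sum>k = 0..<n. ?a k * R \<mu> \<sigma> n k 0 v + ?b k * Q \<mu> n k 0 v)
      + X * (\<Sum>k = 0..<n. ?a k * Q \<mu> n k v ?m + ?b k * S \<mu> \<sigma> n k v ?m))
      + X * (\<Sum>k = 0..<n. ?g k * ?t k))"
    unfolding I c0 using \<sigma> by (simp add: divide_simps)
  also have "\<dots> = 1 / (2 * \<sigma>) ^ (n + 1) *
      (X * (((\<Sum>k = 0..<n. ?g k * ?t k) + (\<Sum>k = 0..<n. TA k)) + (\<Sum>k = 0..<n. ?a k * ?U k))
      + Y * (((\<Sum>k = 0..<n. TB k) + (2 * \<sigma>) ^ n * c n) + (\<Sum>k = 0..<n. ?b k * ?D k)))"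
    unfolding sums by (simp only: distrib_left add_ac)
  finally show ?thesis
    unfolding s_def[symmetric] A B EX[symmetric] EY[symmetric] by (simp only: mult_ac)
qed

text \<open>
  Above \<open>m\<close> every contribution is a multiple of \<open>exp (- v / \<sigma>)\<close>. With \<open>m\<close> left symbolic, the
  recursions before and after the bounded piece disappears become instances: \<open>m - n \<mu>\<close> is \<open>x\<close>
  in the first case, and in the second it is \<open>- n \<mu>\<close> and the sum over the bounded piece is \<open>0\<close>.
\<close>

lemma density_step_above:
  fixes n
  defines "m \<equiv> max 0 (real n * \<mu> + x)"
  assumes rec: "\<And>j. j \<in> {1..n} \<Longrightarrow> b (n + 1) 2 j = exp (\<mu> / \<sigma>) *
      (\<Sum>k = j - 1..<n. b n 2 k * (fact k / fact j) * (\<sigma> / 2) ^ (k + 1 - j))"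
    and rec0: "b (n + 1) 2 0 = exp (\<mu> / \<sigma>) *
      ((\<Sum>k = 0..<n. a n 1 k * R \<mu> \<sigma> n k 0 m + b n 1 k * Q \<mu> n k 0 m)
       + (\<Sum>k = 0..<n. b n 2 k * (- ((m - real n * \<mu>) ^ (k + 1) / real (k + 1)) + fact k * (\<sigma> / 2) ^ (k + 1)))
       + (2 * \<sigma>) ^ n * c n)"
    and v: "0 < u - \<mu>" "m \<le> u - \<mu>"
  shows "c n * laplace_density \<mu> \<sigma> u + (\<integral>y. law_density n y * laplace_density \<mu> \<sigma> (u - y) \<partial>lborel) =
    1 / (2 * \<sigma>) ^ (n + 1) * ((\<Sum>j = 0..<n + 1. b (n + 1) 2 j * (u - real (n + 1) * \<mu>) ^ j) * exp (- u / \<sigma>))"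
proof -
  define v where "v = u - \<mu>"
  define s where "s = u - real (n + 1) * \<mu>"
  define X where "X = exp (v / \<sigma>)"
  define Y where "Y = exp (- v / \<sigma>)"
  have XY: "X * Y = 1" unfolding X_def Y_def by (simp add: exp_add[symmetric])
  have Y2: "exp (- 2 * v / \<sigma>) = Y * Y"
    unfolding Y_def by (simp add: exp_add[symmetric])
  have s: "v - real n * \<mu> = s" unfolding v_def s_def by (simp add: algebra_simps)
  have EY: "exp (\<mu> / \<sigma>) * exp (- u / \<sigma>) = Y"
    unfolding Y_def v_def by (simp add: exp_add[symmetric] diff_divide_distrib add_divide_distrib)
  have m: "0 \<le> m" by (simp add: m_def)
  let ?g = "b n 2"
  let ?E = "\<Sum>k = 0..<n. a n 1 k * R \<mu> \<sigma> n k 0 m + b n 1 k * Q \<mu> n k 0 m"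
  let ?D = "\<lambda>k. poly_down \<sigma> k s - fact k * (\<sigma> / 2) ^ (k + 1) + s ^ (k + 1) / real (k + 1)"
  define T where "T k = ?g k * (- ((m - real n * \<mu>) ^ (k + 1) / real (k + 1)) + fact k * (\<sigma> / 2) ^ (k + 1))" for k
  have B: "(\<Sum>j = 0..<n + 1. b (n + 1) 2 j * s ^ j) = exp (\<mu> / \<sigma>) *
      ((?E + (\<Sum>k = 0..<n. T k) + (2 * \<sigma>) ^ n * c n) + (\<Sum>k = 0..<n. ?g k * ?D k))"
    unfolding poly_down_shifted[symmetric]
  proof (rule polynomial_of_recursion)
    show "b (n + 1) 2 0 = exp (\<mu> / \<sigma>) * (?E + (\<Sum>k = 0..<n. T k) + (2 * \<sigma>) ^ n * c n)"
      unfolding T_def by (rule rec0)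
    show "b (n + 1) 2 j = exp (\<mu> / \<sigma>) * (\<Sum>k = j - 1..<n. ?g k * (fact k / fact j * (\<sigma> / 2) ^ (k + 1 - j)))"
      if "j \<in> {1..n}" for j
      using rec[OF that] by (simp add: mult_ac)
  qed
  have term_eq: "Y * (?g k * Q \<mu> n k m v) + X * (?g k * weighted_tail \<mu> \<sigma> n k v) = Y * (T k + ?g k * ?D k)" for k
  proof -
    have Q: "Q \<mu> n k m v = s ^ (k + 1) / real (k + 1) - (m - real n * \<mu>) ^ (k + 1) / real (k + 1)"
      unfolding Q_def eval_between_def s by simp
    have "X * (Y * Y * z) = Y * z" for z
      using XY by (metis mult.assoc mult.left_neutral)
    then have tl: "X * weighted_tail \<mu> \<sigma> n k v = Y * poly_down \<sigma> k s"
      unfolding weighted_tail_closed_form[OF \<sigma>, of _ _ _ v] s Y2 by simp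
    have "Y * (?g k * Q \<mu> n k m v) + ?g k * (X * weighted_tail \<mu> \<sigma> n k v) = Y * (T k + ?g k * ?D k)"
      unfolding tl Q T_def by (simp add: algebra_simps del: power_Suc)
    then show ?thesis by (simp only: algebra_simps)
  qed
  have "Y * (\<Sum>k = 0..<n. ?g k * Q \<mu> n k m v) + X * (\<Sum>k = 0..<n. ?g k * weighted_tail \<mu> \<sigma> n k v) =
      (\<Sum>k = 0..<n. Y * (T k + ?g k * ?D k))"
    unfolding term_eq[symmetric] by (simp only: sum.distrib sum_distrib_left)
  also have "\<dots> = Y * ((\<Sum>k = 0..<n. T k) + (\<Sum>k = 0..<n. ?g k * ?D k))"
    by (simp only: sum.distrib sum_distrib_left[symmetric])
  finally have sums: "Y * (\<Sum>k = 0..<n. ?g k * Q \<mu> n k m v) + X * (\<Sum>k = 0..<n. ?g k * weighted_tail \<mu> \<sigma> n k v) =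
      Y * ((\<Sum>k = 0..<n. T k) + (\<Sum>k = 0..<n. ?g k * ?D k))" .
  have c0: "laplace_density \<mu> \<sigma> u = Y / (2 * \<sigma>)"
    using laplace_density_eq_exp_kernel[OF \<sigma>, of \<mu> u 0] v by (simp add: exp_kernel_def Y_def v_def)
  have I: "(\<integral>y. law_density n y * laplace_density \<mu> \<sigma> (u - y) \<partial>lborel) = 1 / (2 * \<sigma>) ^ n *
      (Y / (2 * \<sigma>) * ?E
       + Y / (2 * \<sigma>) * (\<Sum>k = 0..<n. ?g k * Q \<mu> n k m v)
       + X / (2 * \<sigma>) * (\<Sum>k = 0..<n. ?g k * weighted_tail \<mu> \<sigma> n k v))"
    unfolding laplace_density_eq_exp_kernel[OF \<sigma>] m_def[symmetric] v_def[symmetric] X_def[symmetric] Y_def[symmetric]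
    by (subst integral_exp_kernel_above[OF \<sigma> m]) (use v v_def in auto)
  have "c n * laplace_density \<mu> \<sigma> u + (\<integral>y. law_density n y * laplace_density \<mu> \<sigma> (u - y) \<partial>lborel) =
     1 / (2 * \<sigma>) ^ (n + 1) * (Y * ((2 * \<sigma>) ^ n * c n) + Y * ?E +
       (Y * (\<Sum>k = 0..<n. ?g k * Q \<mu> n k m v) + X * (\<Sum>k = 0..<n. ?g k * weighted_tail \<mu> \<sigma> n k v)))"
    unfolding I c0 using \<sigma> by (simp add: divide_simps)
  also have "\<dots> = 1 / (2 * \<sigma>) ^ (n + 1) *
      (Y * ((?E + (\<Sum>k = 0..<n. T k) + (2 * \<sigma>) ^ n * c n) + (\<Sum>k = 0..<n. ?g k * ?D k)))"
    unfolding sums by (simp only: distrib_left add_ac)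
  finally show ?thesis
    unfolding s_def[symmetric] B EY[symmetric] by (simp only: mult_ac)
qed

lemma density_step_above_A:
  assumes rec: "recursion_A \<mu> \<sigma> x a b c n" and pos: "0 < x + real n * \<mu>"
    and a2: "\<And>k. k < n \<Longrightarrow> a n 2 k = 0"
    and v: "0 < u - \<mu>" "x + real n * \<mu> \<le> u - \<mu>"
  shows "c n * laplace_density \<mu> \<sigma> u + (\<integral>y. law_density n y * laplace_density \<mu> \<sigma> (u - y) \<partial>lborel) =
    1 / (2 * \<sigma>) ^ (n + 1) * ((\<Sum>j = 0..<n + 1. b (n + 1) 2 j * (u - real (n + 1) * \<mu>) ^ j) * exp (- u / \<sigma>))"
proof (rule density_step_above)
  have m: "max 0 (real n * \<mu> + x) = x + real n * \<mu>" using pos by (simp add: add.commute)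
  show "max 0 (real n * \<mu> + x) \<le> u - \<mu>" using v m by simp
  have "(\<Sum>k = 0..<n. b n 2 k * (- (x ^ (k + 1) / real (k + 1)) + fact k * (\<sigma> / 2) ^ (k + 1))
        - a n 2 k * (exp (2 * real n * \<mu> / \<sigma>) * \<sigma> ^ (k + 1) * (- 1) ^ k / 2 ^ (k + 1)) *
            inc_Gamma (1 + k) (- (2 * x / \<sigma>))) =
      (\<Sum>k = 0..<n. b n 2 k * (- (x ^ (k + 1) / real (k + 1)) + fact k * (\<sigma> / 2) ^ (k + 1)))"
    using a2 by (intro sum.cong) auto
  then show "b (n + 1) 2 0 = exp (\<mu> / \<sigma>) *
      ((\<Sum>k = 0..<n. a n 1 k * R \<mu> \<sigma> n k 0 (max 0 (real n * \<mu> + x)) + b n 1 k * Q \<mu> n k 0 (max 0 (real n * \<mu> + x)))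
       + (\<Sum>k = 0..<n. b n 2 k * (- ((max 0 (real n * \<mu> + x) - real n * \<mu>) ^ (k + 1) / real (k + 1)) + fact k * (\<sigma> / 2) ^ (k + 1)))
       + (2 * \<sigma>) ^ n * c n)"
    using rec unfolding recursion_A_def B1_def m by (simp add: add.assoc)
qed (use rec v in \<open>auto simp: recursion_A_def\<close>)

lemma density_step_above_B:
  assumes rec: "recursion_B \<mu> \<sigma> a b c n" and neg: "x + real n * \<mu> \<le> 0"
    and a2: "\<And>k. k < n \<Longrightarrow> a n 2 k = 0"
    and v: "0 < u - \<mu>"
  shows "c n * laplace_density \<mu> \<sigma> u + (\<integral>y. law_density n y * laplace_density \<mu> \<sigma> (u - y) \<partial>lborel) =
    1 / (2 * \<sigma>) ^ (n + 1) * ((\<Sum>j = 0..<n + 1. b (n + 1) 2 j * (u - real (n + 1) * \<mu>) ^ j) * exp (- u / \<sigma>))"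
proof (rule density_step_above)
  have m: "max 0 (real n * \<mu> + x) = 0" using neg by (simp add: add.commute)
  show "max 0 (real n * \<mu> + x) \<le> u - \<mu>" using v m by simp
  have "(\<Sum>k = 0..<n. b n 2 k * (- ((- real n * \<mu>) ^ (k + 1) / real (k + 1)) + fact k * (\<sigma> / 2) ^ (k + 1))
        - a n 2 k * (exp (2 * real n * \<mu> / \<sigma>) * \<sigma> ^ (k + 1) * (- 1) ^ k / 2 ^ (k + 1)) *
            inc_Gamma (1 + k) (2 * real n * \<mu> / \<sigma>)) =
      (\<Sum>k = 0..<n. b n 2 k * (- ((0 - real n * \<mu>) ^ (k + 1) / real (k + 1)) + fact k * (\<sigma> / 2) ^ (k + 1)))"
    using a2 by (intro sum.cong) auto
  moreover have "(\<Sum>k = 0..<n. a n 1 k * R \<mu> \<sigma> n k 0 0 + b n 1 k * Q \<mu> n k 0 0) = 0"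
    by (simp add: R_def Q_def)
  ultimately show "b (n + 1) 2 0 = exp (\<mu> / \<sigma>) *
      ((\<Sum>k = 0..<n. a n 1 k * R \<mu> \<sigma> n k 0 (max 0 (real n * \<mu> + x)) + b n 1 k * Q \<mu> n k 0 (max 0 (real n * \<mu> + x)))
       + (\<Sum>k = 0..<n. b n 2 k * (- ((max 0 (real n * \<mu> + x) - real n * \<mu>) ^ (k + 1) / real (k + 1)) + fact k * (\<sigma> / 2) ^ (k + 1)))
       + (2 * \<sigma>) ^ n * c n)"
    using rec unfolding recursion_B_def m by (simp only: add_0_left)
qed (use rec v in \<open>auto simp: recursion_B_def\<close>)

abbreviation "hit_zero_prob w \<equiv> \<integral>z. laplace_density \<mu> \<sigma> z * indicator {..- w} z \<partial>lborel"

text \<open>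
  The two indicators in the recursion for \<open>c\<close> decide whether the threshold \<open>- \<mu>\<close> lies below or above
  \<open>m = x + n \<mu>\<close>, so exactly one of the two summands is present.
\<close>

lemma atom_step_A:
  assumes rec: "recursion_A \<mu> \<sigma> x a b c n" and pos: "0 < x + real n * \<mu>"
    and a2: "\<And>k. k < n \<Longrightarrow> a n 2 k = 0" and "0 < x" "\<mu> < 0"
  shows "c (n + 1) = c n * hit_zero_prob 0 + (\<integral>y. law_density n y * hit_zero_prob y \<partial>lborel)"
proof -
  have m: "max 0 (real n * \<mu> + x) = x + real n * \<mu>" using pos by (simp add: add.commute)
  have t0: "hit_zero_prob 0 = 1 - exp (\<mu> / \<sigma>) / 2"
    unfolding laplace_cdf_eq_exp_kernel[OF \<sigma>] exp_kernel_def using \<open>\<mu> < 0\<close> by simp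
  have cn: "c (n + 1) = f_tilde \<mu> \<sigma> x a b c n + f_tilde_tilde \<mu> \<sigma> x a b c n"
    using rec by (simp add: recursion_A_def)
  have pw: "2 ^ (n + 1) * \<sigma> ^ n = 2 * (2 * \<sigma>) ^ n" by (simp add: power_mult_distrib)
  show ?thesis
  proof (cases "- real (n + 1) * \<mu> \<le> x")
    case True
    then have v: "0 \<le> - \<mu>" "- \<mu> \<le> x + real n * \<mu>" using \<open>\<mu> < 0\<close> by (auto simp: algebra_simps)
    have zero: "f_tilde \<mu> \<sigma> x a b c n = 0" using True by (simp add: f_tilde_def)
    have ind: "indicator {- real (n + 1) * \<mu>..} x = (1 :: real)" using True by simp
    have tl: "y * (exp (- 2 * real n * \<mu> / \<sigma>) * \<sigma> ^ (k + 1) / 2 ^ (k + 1)) * inc_Gamma (1 + k) (2 * x / \<sigma>) =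
        y * weighted_tail \<mu> \<sigma> n k (x + real n * \<mu>)" for y k
      by (simp add: weighted_tail_def)
    have "1 / N * A - e / (2 * N) * B + E / (2 * N) * C + E / (2 * N) * D + (1 - e / 2) * z =
        z * (1 - e / 2) + 1 / N * (1 * A + - (e / 2) * B + E / 2 * C + E / 2 * D)" for N A B C D E e z :: real
      by (simp add: algebra_simps add_divide_distrib diff_divide_distrib)
    then show ?thesis
      unfolding cn zero add_0_left f_tilde_tilde_def ind mult_1_right pw tl t0
        laplace_cdf_eq_exp_kernel[OF \<sigma>] m integral_exp_kernel_below[OF \<sigma> v] .
  next
    case False
    then have v: "x + real n * \<mu> \<le> - \<mu>" "0 \<le> x + real n * \<mu>" using pos by (auto simp: algebra_simps)
    have zero: "f_tilde_tilde \<mu> \<sigma> x a b c n = 0" using False by (simp add: f_tilde_tilde_def)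
    have ind: "indicator {0..<- real (n + 1) * \<mu>} x = (1 :: real)" using False \<open>0 < x\<close> by simp
    have tl: "y * (exp (- 2 * real n * \<mu> / \<sigma>) * \<sigma> ^ (k + 1) / 2 ^ (k + 1)) * inc_Gamma (1 + k) (- 2 * real (n + 1) * \<mu> / \<sigma>) =
        y * weighted_tail \<mu> \<sigma> n k (- \<mu>)" for y k
      by (simp add: weighted_tail_def algebra_simps)
    have drop: "(\<Sum>k = 0..<n. a n 2 k * f k + g k) = (\<Sum>k = 0..<n. g k)" for f g
      using a2 by simp
    have "1 / N * A - e / (2 * N) * B + 1 / N * C - e / (2 * N) * D + E / (2 * N) * F + (1 - e / 2) * z =
        z * (1 - e / 2) + 1 / N * (1 * A + - (e / 2) * B + 1 * C + - (e / 2) * D + E / 2 * F)" for N A B C D E F e z :: real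
      by (simp add: algebra_simps add_divide_distrib diff_divide_distrib)
    then show ?thesis
      unfolding cn zero add_0_right f_tilde_def ind mult_1_right pw tl drop t0
        laplace_cdf_eq_exp_kernel[OF \<sigma>] m integral_exp_kernel_above[OF \<sigma> v(2,1)] .
  qed
qed

lemma atom_step_B:
  assumes rec: "recursion_B \<mu> \<sigma> a b c n" and neg: "x + real n * \<mu> \<le> 0" and "\<mu> < 0"
  shows "c (n + 1) = c n * hit_zero_prob 0 + (\<integral>y. law_density n y * hit_zero_prob y \<partial>lborel)"
proof -
  have m: "max 0 (real n * \<mu> + x) = 0" using neg by (simp add: add.commute)
  have t0: "hit_zero_prob 0 = 1 - exp (\<mu> / \<sigma>) / 2"
    unfolding laplace_cdf_eq_exp_kernel[OF \<sigma>] exp_kernel_def using \<open>\<mu> < 0\<close> by simp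
  have pw: "2 ^ (n + 1) * \<sigma> ^ n = 2 * (2 * \<sigma>) ^ n" by (simp add: power_mult_distrib)
  have v: "(0::real) \<le> 0" "0 \<le> - \<mu>" using \<open>\<mu> < 0\<close> by auto
  have tl: "y * (exp (- 2 * real n * \<mu> / \<sigma>) * \<sigma> ^ (k + 1) / 2 ^ (k + 1)) * inc_Gamma (1 + k) (- 2 * real (n + 1) * \<mu> / \<sigma>) =
      y * weighted_tail \<mu> \<sigma> n k (- \<mu>)" for y k
    by (simp add: weighted_tail_def algebra_simps)
  have zero: "(\<Sum>k = 0..<n. a n 1 k * G \<mu> \<sigma> n k 0 0 + b n 1 k * H \<mu> \<sigma> n k 0 0) = 0"
    "(\<Sum>k = 0..<n. a n 1 k * R \<mu> \<sigma> n k 0 0 + b n 1 k * Q \<mu> n k 0 0) = 0"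
    by (simp_all add: R_def Q_def G_def H_def)
  have cn: "c (n + 1) =
      1 / (2 * \<sigma>) ^ n * (\<Sum>k = 0..<n. b n 2 k * H \<mu> \<sigma> n k 0 (- \<mu>))
      - exp (\<mu> / \<sigma>) / (2 * (2 * \<sigma>) ^ n) * (\<Sum>k = 0..<n. b n 2 k * Q \<mu> n k 0 (- \<mu>))
      + exp (- \<mu> / \<sigma>) / (2 * (2 * \<sigma>) ^ n) * (\<Sum>k = 0..<n. b n 2 k * weighted_tail \<mu> \<sigma> n k (- \<mu>))
      + (1 - exp (\<mu> / \<sigma>) / 2) * c n"
    using rec unfolding recursion_B_def pw tl by blast
  have "1 / N * C - e / (2 * N) * D + E / (2 * N) * F + (1 - e / 2) * z =
      z * (1 - e / 2) + 1 / N * (1 * 0 + - (e / 2) * 0 + 1 * C + - (e / 2) * D + E / 2 * F)" for N C D E F e z :: real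
    by (simp add: algebra_simps add_divide_distrib diff_divide_distrib)
  then show ?thesis
    unfolding cn t0 laplace_cdf_eq_exp_kernel[OF \<sigma>] m integral_exp_kernel_above[OF \<sigma> v] zero .
qed

end


section \<open>The law of the Lindley process\<close>

lemma mixed_law_cong_AE:
  assumes "mixed_law M X c p" and p': "p' \<in> borel_measurable borel" and ae: "AE y in lborel. p y = p' y"
  shows "mixed_law M X c p'"
proof -
  have p: "integrable lborel p" using assms(1) by (simp add: mixed_law_def)
  have "integrable lborel p'" using p integrable_cong_AE[of p lborel p'] p' ae by auto
  moreover have "(\<integral>y. p y * h y \<partial>lborel) = (\<integral>y. p' y * h y \<partial>lborel)" if "h \<in> borel_measurable borel" for h
    using ae by (intro integral_cong_AE) (use p p' that in auto)
  ultimately show ?thesis using assms(1) by (simp add: mixed_law_def)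
qed

text \<open>
  In the inductive step, the density produced by the reflected step is compared with the explicit
  formula away from the new breakpoint. If \<open>u\<close> lies in the bounded
  piece at time \<open>n + 1\<close>, then \<open>u - \<mu> < x + n \<mu>\<close> lies in the bounded piece at time \<open>n\<close>, which is
  therefore nonempty since \<open>\<mu> < 0 < u\<close>; otherwise \<open>u - \<mu>\<close> exceeds the old breakpoint.
\<close>

lemma mixed_law_lindley:
  fixes Z :: "nat \<Rightarrow> 'a \<Rightarrow> real"
  assumes M: "prob_space M" and ind: "prob_space.indep_vars M (\<lambda>_. borel) Z {1..}"
    and dist: "\<And>n. n \<ge> 1 \<Longrightarrow> distributed M lborel (Z n) (\<lambda>z. ennreal (laplace_density \<mu> \<sigma> z))"
    and \<sigma>: "\<sigma> > 0" and x: "x > 0" and \<mu>: "- x < \<mu>" "\<mu> < 0"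
    and coeff: "lindley_coefficients \<mu> \<sigma> x a b c" and "n \<ge> 1"
  shows "(\<forall>k<n. a n 2 k = 0) \<and>
    mixed_law M (lindley x Z n) (c n) (exp_poly_density \<mu> \<sigma> n (a n 1) (b n 1) (b n 2) (max 0 (real n * \<mu> + x)))"
  using \<open>n \<ge> 1\<close>
proof (induction n rule: nat_induct_at_least)
  interpret prob_space M by fact
  have nn: "0 \<le> laplace_density \<mu> \<sigma> z" for z using \<sigma> by (simp add: laplace_density_def)
  have [measurable]: "laplace_density \<mu> \<sigma> \<in> borel_measurable borel"
    unfolding laplace_density_def[abs_def] by simp
  have int: "integrable lborel (laplace_density \<mu> \<sigma>)"
    using distributed_integrable[OF dist[of 1], of "\<lambda>_. 1"] nn by simp
  {
    case base
    have init: "initial_values \<mu> \<sigma> x a b c" using coeff by (simp add: lindley_coefficients_def)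
    have c1: "(\<integral>z. laplace_density \<mu> \<sigma> z * indicator {..- x} z \<partial>lborel) = c 1"
      unfolding laplace_cdf_eq_exp_kernel[OF \<sigma>] using init \<mu>
      by (simp add: exp_kernel_def initial_values_def exp_add[symmetric] add_divide_distrib diff_divide_distrib)
    have L: "mixed_law M (\<lambda>\<omega>. max 0 (x + Z 1 \<omega>)) (c 1) (\<lambda>u. indicator {0<..} u * laplace_density \<mu> \<sigma> (u - x))"
      using mixed_law_initial_step[OF dist nn int, of 1 x] by (simp add: c1)
    have "AE u in lborel. indicator {0<..} u * laplace_density \<mu> \<sigma> (u - x) =
        exp_poly_density \<mu> \<sigma> 1 (a 1 1) (b 1 1) (b 1 2) (max 0 (real 1 * \<mu> + x)) u"
      using AE_lborel_singleton[of "\<mu> + x"]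
    proof eventually_elim
      case (elim u)
      have "exp ((u - \<mu>) / \<sigma>) * exp (- x / \<sigma>) = exp (- (\<mu> + x) / \<sigma>) * exp (u / \<sigma>)"
        "exp (- (u - \<mu>) / \<sigma>) * exp (x / \<sigma>) = exp ((\<mu> + x) / \<sigma>) * exp (- u / \<sigma>)"
        by (simp_all add: exp_add[symmetric] diff_divide_distrib add_divide_distrib)
      moreover have "max 0 (real 1 * \<mu> + x) = \<mu> + x" using \<mu> by simp
      ultimately show ?case
        using elim init \<mu>
        unfolding laplace_density_eq_exp_kernel[OF \<sigma>]
        by (auto simp: exp_poly_density_def exp_kernel_def initial_values_def indicator_def)
    qed
    from mixed_law_cong_AE[OF L _ this] init show ?case
      by (simp add: initial_values_def)
  next
    case (Suc n)
    let ?p = "exp_poly_density \<mu> \<sigma> n (a n 1) (b n 1) (b n 2) (max 0 (real n * \<mu> + x))"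
    let ?q = "exp_poly_density \<mu> \<sigma> (n + 1) (a (n + 1) 1) (b (n + 1) 1) (b (n + 1) 2) (max 0 (real (n + 1) * \<mu> + x))"
    let ?F = "\<lambda>w. \<integral>z. laplace_density \<mu> \<sigma> z * indicator {..- w} z \<partial>lborel"
    let ?r = "\<lambda>u. c n * laplace_density \<mu> \<sigma> u + (\<integral>w. ?p w * laplace_density \<mu> \<sigma> (u - w) \<partial>lborel)"
    from Suc.IH have a2: "\<And>k. k < n \<Longrightarrow> a n 2 k = 0" and law: "mixed_law M (lindley x Z n) (c n) ?p" by auto
    have recA: "recursion_A \<mu> \<sigma> x a b c n" if "0 < x + real n * \<mu>"
      using that coeff Suc.hyps by (simp add: lindley_coefficients_def)
    have recB: "recursion_B \<mu> \<sigma> a b c n" if "x + real n * \<mu> \<le> 0"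
      using that coeff Suc.hyps by (simp add: lindley_coefficients_def)
    have a2': "a (n + 1) 2 k = 0" if "k < n + 1" for k
    proof (cases "0 < x + real n * \<mu>")
      case True
      show ?thesis
      proof (cases "k = 0")
        case False
        then have "k \<in> {1..n}" using that by auto
        then have "a (n + 1) 2 k = exp (- \<mu> / \<sigma>) *
          (\<Sum>i = k - 1..<n. (- 1) ^ (i + k) * a n 2 i * (fact i / fact k) * (\<sigma> / 2) ^ (i + 1 - k))"
          using recA[OF True] unfolding recursion_A_def by blast
        also have "\<dots> = 0" using a2 by simp
        finally show ?thesis .
      qed (use recA[OF True] in \<open>auto simp: recursion_A_def\<close>)
    next
      case False
      then show ?thesis
        using that recB by (cases "k = 0") (auto simp: recursion_B_def)
    qed
    have cn: "c n * ?F 0 + (\<integral>w. ?p w * ?F w \<partial>lborel) = c (n + 1)"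
    proof (cases "0 < x + real n * \<mu>")
      case True
      show ?thesis by (rule atom_step_A[OF \<sigma> recA[OF True] True a2 x \<mu>(2), symmetric])
    next
      case False
      then have neg: "x + real n * \<mu> \<le> 0" by simp
      show ?thesis by (rule atom_step_B[OF \<sigma> recB[OF neg] neg \<mu>(2), symmetric])
    qed
    have L: "mixed_law M (\<lambda>\<omega>. max 0 (lindley x Z n \<omega> + Z (Suc n) \<omega>)) (c (n + 1)) (\<lambda>u. indicator {0<..} u * ?r u)"
      using mixed_law_step[OF M lindley_indep_next_increment[OF M ind] dist nn int law] unfolding cn by simp
    have "AE u in lborel. indicator {0<..} u * ?r u = ?q u"
      using AE_lborel_singleton[of "max 0 (real (n + 1) * \<mu> + x)"]
    proof eventually_elim
      case (elim u)
      have m: "max 0 (real (n + 1) * \<mu> + x) = max 0 (\<mu> + (x + real n * \<mu>))"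
        by (simp add: algebra_simps)
      consider "u \<le> 0" | "0 < u" "u - \<mu> < x + real n * \<mu>" | "0 < u" "x + real n * \<mu> < u - \<mu>"
        using elim m by fastforce
      then show ?case
      proof cases
        case 1
        then show ?thesis by (auto simp: exp_poly_density_def indicator_def)
      next
        case 2
        then have pos: "0 < x + real n * \<mu>" using \<mu> by linarith
        have "u < max 0 (real (n + 1) * \<mu> + x)" using 2 m by auto
        then show ?thesis
          using 2 \<mu> density_step_below[OF \<sigma> recA[OF pos] pos, of u]
          by (simp add: exp_poly_density_def del: of_nat_Suc of_nat_add sum.op_ivl_Suc)
      next
        case 3
        have "max 0 (real (n + 1) * \<mu> + x) < u" using 3 m by auto
        moreover have "?r u = 1 / (2 * \<sigma>) ^ (n + 1) *
            ((\<Sum>j = 0..<n + 1. b (n + 1) 2 j * (u - real (n + 1) * \<mu>) ^ j) * exp (- u / \<sigma>))"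
        proof (cases "0 < x + real n * \<mu>")
          case True
          show ?thesis
            by (rule density_step_above_A[OF \<sigma> recA[OF True] True a2]) (use 3 \<mu> in auto)
        next
          case False
          then have neg: "x + real n * \<mu> \<le> 0" by simp
          show ?thesis
            by (rule density_step_above_B[OF \<sigma> recB[OF neg] neg a2]) (use 3 \<mu> in auto)
        qed
        ultimately show ?thesis
          using 3 by (simp add: exp_poly_density_def del: of_nat_Suc of_nat_add sum.op_ivl_Suc)
      qed
    qed
    from mixed_law_cong_AE[OF L _ this] a2' show ?case by (simp del: of_nat_Suc of_nat_add)
  }
qed

lemma test_function_bounded:
  assumes "test_function \<phi>"
  obtains C where "\<And>u. \<bar>\<phi> u\<bar> \<le> C"
proof -
  obtain r where r: "\<And>u. r < \<bar>u\<bar> \<Longrightarrow> \<phi> u = 0"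
    using test_function_support[OF assms] by blast
  have "continuous_on {- r..r} \<phi>"
    using test_function_derivative(1)[OF assms] DERIV_isCont continuous_at_imp_continuous_on by blast
  then have "bounded (\<phi> ` {- r..r})"
    by (intro compact_imp_bounded compact_continuous_image) auto
  then obtain C where "\<forall>y\<in>\<phi> ` {- r..r}. norm y \<le> C"
    unfolding bounded_iff by blast
  then have C: "\<bar>\<phi> u\<bar> \<le> C" if "u \<in> {- r..r}" for u using that by auto
  have "\<bar>\<phi> u\<bar> \<le> max C 0" for u
  proof (cases "u \<in> {- r..r}")
    case True
    then show ?thesis using C[of u] by simp
  next
    case False
    then have "r < \<bar>u\<bar>" by auto
    then show ?thesis using r by simp
  qed
  then show thesis by (rule that)
qed

theorem theorem3p8:
  fixes M :: "'a measure" and Z :: "nat \<Rightarrow> 'a \<Rightarrow> real"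
    and \<mu> \<sigma> x :: real
    and a b :: "nat \<Rightarrow> nat \<Rightarrow> nat \<Rightarrow> real" and c :: "nat \<Rightarrow> real"
  assumes "prob_space M"
    and "prob_space.indep_vars M (\<lambda>_. borel) Z {1..}"
    and "\<And>n. n \<ge> 1 \<Longrightarrow> distributed M lborel (Z n) (\<lambda>z. ennreal (laplace_density \<mu> \<sigma> z))"
    and "\<sigma> > 0" and "x > 0" and "- x < \<mu>" and "\<mu> < 0"
    and "lindley_coefficients \<mu> \<sigma> x a b c"
  shows "has_distributional_derivative
           (\<lambda>u. measure M {\<omega> \<in> space M. lindley x Z 0 \<omega> \<le> u}) (dirac x) \<and>
         (\<forall>n \<ge> 1.
            has_distributional_derivative
              (\<lambda>u. measure M {\<omega> \<in> space M. lindley x Z n \<omega> \<le> u})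
              (\<lambda>\<phi>. c n * dirac 0 \<phi>
                 + regular_distribution (density_piece \<mu> \<sigma> a b n 1 (I1 \<mu> x n)) \<phi>
                 + regular_distribution (density_piece \<mu> \<sigma> a b n 2 (I2 \<mu> x n)) \<phi>) \<and>
            (x + real n * \<mu> < 0 \<longrightarrow> density_piece \<mu> \<sigma> a b n 1 (I1 \<mu> x n) = (\<lambda>u. 0)))"
proof (intro conjI allI impI)
  interpret prob_space M by fact
  have meas [measurable]: "lindley x Z n \<in> borel_measurable M" for n
    using lindley_indep_next_increment[OF assms(1,2), of x n] by (simp add: indep_var_distribution_eq)
  note cdf = cdf_has_distributional_derivative[OF assms(1) meas]
  have "(\<lambda>\<phi>. \<integral>\<omega>. \<phi> (lindley x Z 0 \<omega>) \<partial>M) = dirac x"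
    by (simp add: fun_eq_iff dirac_def prob_space)
  then show "has_distributional_derivative (\<lambda>u. measure M {\<omega> \<in> space M. lindley x Z 0 \<omega> \<le> u}) (dirac x)"
    using cdf[of 0] by (simp only:)
  fix n :: nat assume "n \<ge> 1"
  let ?p1 = "density_piece \<mu> \<sigma> a b n 1 (I1 \<mu> x n)" and ?p2 = "density_piece \<mu> \<sigma> a b n 2 (I2 \<mu> x n)"
  let ?m = "max 0 (real n * \<mu> + x)"
  from mixed_law_lindley[OF assms \<open>n \<ge> 1\<close>]
  have a2: "\<And>k. k < n \<Longrightarrow> a n 2 k = 0"
    and law: "mixed_law M (lindley x Z n) (c n) (exp_poly_density \<mu> \<sigma> n (a n 1) (b n 1) (b n 2) ?m)"
    by auto
  have p1: "?p1 = exp_poly_density \<mu> \<sigma> n (a n 1) (b n 1) (\<lambda>_. 0) ?m"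
    and p2: "?p2 = exp_poly_density \<mu> \<sigma> n (\<lambda>_. 0) (\<lambda>_. 0) (b n 2) ?m"
    by (rule density_piece_lower, rule density_piece_upper) (fact a2)
  have i1: "integrable lborel ?p1" and i2: "integrable lborel ?p2"
    unfolding p1 p2 by (simp_all add: integrable_exp_poly_density[OF \<open>\<sigma> > 0\<close>])
  have sum: "exp_poly_density \<mu> \<sigma> n (a n 1) (b n 1) (b n 2) ?m y = ?p1 y + ?p2 y" for y
    unfolding p1 p2 exp_poly_density_def by (simp add: algebra_simps)
  show "has_distributional_derivative (\<lambda>u. measure M {\<omega> \<in> space M. lindley x Z n \<omega> \<le> u})
              (\<lambda>\<phi>. c n * dirac 0 \<phi> + regular_distribution ?p1 \<phi> + regular_distribution ?p2 \<phi>)"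
    unfolding has_distributional_derivative_def
  proof (intro allI impI)
    fix \<phi> :: "real \<Rightarrow> real" assume tf: "test_function \<phi>"
    obtain C where C: "\<And>u. \<bar>\<phi> u\<bar> \<le> C" using test_function_bounded[OF tf] by blast
    have meas\<phi>: "\<phi> \<in> borel_measurable borel"
      using test_function_derivative(1)[OF tf]
      by (intro borel_measurable_continuous_onI) (meson DERIV_isCont continuous_at_imp_continuous_on)
    have "(\<integral>\<omega>. \<phi> (lindley x Z n \<omega>) \<partial>M) = c n * \<phi> 0 + (\<integral>y. ?p1 y * \<phi> y + ?p2 y * \<phi> y \<partial>lborel)"
      using mixed_law_expectation[OF law meas\<phi> C] by (simp only: sum distrib_right)
    also have "(\<integral>y. ?p1 y * \<phi> y + ?p2 y * \<phi> y \<partial>lborel) = (\<integral>y. ?p1 y * \<phi> y \<partial>lborel) + (\<integral>y. ?p2 y * \<phi> y \<partial>lborel)"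
      using integrable_mult_bounded[OF i1 meas\<phi> C] integrable_mult_bounded[OF i2 meas\<phi> C]
      by (rule Bochner_Integration.integral_add)
    finally show "c n * dirac 0 \<phi> + regular_distribution ?p1 \<phi> + regular_distribution ?p2 \<phi> =
        - (\<integral>u. measure M {\<omega> \<in> space M. lindley x Z n \<omega> \<le> u} * deriv \<phi> u \<partial>lborel)"
      using cdf[of n] tf by (simp add: has_distributional_derivative_def dirac_def regular_distribution_def)
  qed
  assume "x + real n * \<mu> < 0"
  then have "I1 \<mu> x n = {}" by (simp add: I1_def)
  then show "?p1 = (\<lambda>u. 0)" by (simp add: density_piece_def fun_eq_iff)
qed

end
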